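(* Consider the boundary term $$\oint_{\partial\Omega}U^T\tilde A(V)U\,ds=\oint_{\partial\Omega}W^T\Lambda W\,ds=\oint_{\partial\Omega}\big((W^+)^T\Lambda^+W^++(W^-)^T\Lambda^-W^-\big)ds$$ and the boundary conditions $S(W^--RW^+)=G$, equivalently $W^-=RW^++S^{-1}G$, on $\partial\Omega$, implemented strongly, or weakly using the lifting operator $L_C\big(2(J^-T^{-1})^T\Sigma(W^--RW^+-S^{-1}G)\big)$. Let $|\Lambda^-|=\mathrm{diag}(|\lambda_i^-|)$ and $|\Lambda^-|^{1/2}=\mathrm{diag}(\sqrt{|\lambda_i^-|})$. 1. (Strong nonlinear homogeneous boundary conditions, $G=0$.) The boundary term augmented with the strongly imposed boundary conditions is positive semi-definite if the matrix $R$ is such that $$\Lambda^+-R^T|\Lambda^-|R\ \ge\ 0 .\qquad (\mathrm{I})$$ 2. (Strong nonlinear inhomogeneous boundary conditions, $G\ne0$.) The boundary term augmented with the strongly imposed boundary conditions is bounded by external given data if $R$ satisfies (I) with strict inequality and the matrix $S$ satisfies $$S=\tilde S^{-1}|\Lambda^-|^{1/2}\quad\text{with }\tilde S\text{ sufficiently small}.\qquad(\mathrm{II})$$ 3. (Weak nonlinear homogeneous boundary conditions, $G=0$.) The boundary term augmented with the weakly imposed boundary conditions is positive semi-definite if $R$ satisfies (I) and the matrix $\Sigma$ satisfies $$\Sigma=|\Lambda^-| .\qquad(\mathrm{III})$$ 4. (Weak nonlinear inhomogeneous boundary conditions, $G\neq0$.) The boundary term augmented with the weakly imposed boundary conditions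 is bounded by external given data if $R$ satisfies (I) with strict inequality, $S$ satisfies (II) and $\Sigma$ satisfies (III).
   Context: Setting. $U,V$ are smooth $n$-component vector functions, with $V=U$ (nonlinear case) or $V\neq U$ given (linear case). They come from the hyperbolic problem $PU_t+(A_i(V)U)_{x_i}+A_i^T(V)U_{x_i}+C(V)U=0$ in a domain $\Omega\subset\mathbb{R}^k$ with outward unit normal $(n_1,\dots,n_k)$ (summation convention), and $\tilde A(V)=\tfrac12\big((n_iA_i)+(n_iA_i)^T\big)$ is the symmetric $n\times n$ matrix on $\partial\Omega$ with $U^T(n_iA_i)U=U^T\tilde AU$. Rotated variables. $T$ is a non-singular (possibly solution-dependent) matrix and $W=T^{-1}U$ are variables such that, at each boundary point, $U^T\tilde AU=W^T\Lambda W=\sum_i\lambda_iW_i^2$ with $\Lambda=\mathrm{diag}(\lambda_i)$ (possibly solution-dependent, $\Lambda=\Lambda(U)$, and not a priori bounded). $\Lambda^+$ and $\Lambda^-$ are the diagonal blocks of positive, respectively negative, entries $\lambda_i^+$, $\lambda_i^-$ of $\Lambda$, and $W^+=J^+W$, $W^-=J^-W$ are the corresponding components of $W$ ($J^\pm$ are selection matrices), so that $W^T\Lambda W=(W^+)^T\Lambda^+W^++(W^-)^T\Lambda^-W^-$. Boundary conditions. $S$ is a non-singular matrix, $R$ a matrix, $\Sigma$ a penalty matrix (all of compatible size, possibly solution-dependent), and $G$ is a vector of given external data. Strong imposition: the relation $W^-=RW^++S^{-1}G$ holds exactly at each boundary point, and the "boundary term augmented with strong boundary conditions" is $\oint_{\partial\Omega}W^T\Lambda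 W\,ds$ with this relation imposed. Weak imposition: the term $L_C(2(J^-T^{-1})^T\Sigma(W^--RW^+-S^{-1}G))$ is added to the left-hand side of the differential equation, where the lifting operator satisfies $\int_\Omega\Phi^TL_C(\Psi)\,d\Omega=\oint_{\partial\Omega}\Phi^T\Psi\,ds$ for smooth vector functions $\Phi,\Psi$; the relation between $W^-$ and $W^+$ is not imposed exactly. The "boundary term augmented with weak boundary conditions" is the resulting total boundary contribution when the equation is multiplied by $U^T$ and integrated, $$\oint_{\partial\Omega}\Big(W^T\Lambda W+2U^T(J^-T^{-1})^T\Sigma(W^--RW^+-S^{-1}G)\Big)ds=\oint_{\partial\Omega}\Big(W^T\Lambda W+2(W^-)^T\Sigma(W^--RW^+-S^{-1}G)\Big)ds .$$ Terminology. Matrix inequalities ($\ge0$, and strict $>0$) are in the sense of symmetric positive semi-definite (definite) matrices, pointwise on $\partial\Omega$. "Positive semi-definite" means the augmented boundary term is $\ge0$. "Bounded by external given data" means the augmented boundary term is bounded from below by $-\oint_{\partial\Omega}G^TG\,ds$. "$\tilde S$ sufficiently small" means: $\tilde S$ is non-singular and at each boundary point $\|\tilde S\|\le\delta$ for some $\delta>0$ which may depend on $\Lambda^+$, $\Lambda^-$ and $R$ at that point. *)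

theory Defs
  imports
    "HOL-Analysis.Analysis"
    "Jordan_Normal_Form.DL_Submatrix"
    "Jordan_Normal_Form.Gauss_Jordan_Elimination"
begin

unbundle no inner_syntax
unbundle no vec_syntax

section \<open>Surface integrals\<close>

text \<open>
  The surface measure on the boundary is the \<open>(k - 1)\<close>-dimensional Hausdorff measure, normalised
  so that it agrees with the usual surface area (counting measure for \<open>k = 1\<close>).
  Boundedness of the covering sets is required because \<^const>\<open>diameter\<close> is a junk value on
  unbounded sets.
\<close>

definition hausdorff_gauge :: "nat \<Rightarrow> 'a::metric_space set \<Rightarrow> ennreal" where
  "hausdorff_gauge d C = ennreal (if C = {} then 0 else unit_ball_vol (real d) * (diameter C / 2) ^ d)"

definition hausdorff_content :: "nat \<Rightarrow> real \<Rightarrow> 'a::metric_space set \<Rightarrow> ennreal" where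
  "hausdorff_content d \<delta> X =
     (INF C \<in> {C :: nat \<Rightarrow> 'a set. X \<subseteq> (\<Union>i. C i) \<and> (\<forall>i. bounded (C i) \<and> diameter (C i) \<le> \<delta>)}.
        \<Sum>i. hausdorff_gauge d (C i))"

definition hausdorff_outer :: "nat \<Rightarrow> 'a::metric_space set \<Rightarrow> ennreal" where
  "hausdorff_outer d X = (SUP \<delta>\<in>{0<..}. hausdorff_content d \<delta> X)"

definition hausdorff_measure :: "nat \<Rightarrow> 'a::metric_space measure" where
  "hausdorff_measure d = measure_of UNIV (sets borel) (hausdorff_outer d)"

text \<open>
  \<^const>\<open>measure_of\<close> yields the null measure when its argument is not countably additive; the following
  lemmas show that this does not happen, i.e. that all Borel sets are Caratheodory measurable.
\<close>

lemma hausdorff_gauge_empty [simp]: "hausdorff_gauge d {} = 0"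
  by (simp add: hausdorff_gauge_def)

lemma hausdorff_content_le:
  assumes "X \<subseteq> (\<Union>i. C i)" "\<And>i. bounded (C i)" "\<And>i. diameter (C i) \<le> \<delta>"
  shows "hausdorff_content d \<delta> X \<le> (\<Sum>i. hausdorff_gauge d (C i))"
  unfolding hausdorff_content_def using assms by (intro INF_lower) auto

lemma hausdorff_content_mono:
  assumes "X \<subseteq> Y"
  shows "hausdorff_content d \<delta> X \<le> hausdorff_content d \<delta> Y"
  unfolding hausdorff_content_def using assms by (intro INF_superset_mono) auto

lemma hausdorff_content_antimono:
  assumes "\<epsilon> \<le> \<delta>"
  shows "hausdorff_content d \<delta> X \<le> hausdorff_content d \<epsilon> X"
  unfolding hausdorff_content_def using assms
  by (intro INF_superset_mono) (auto intro: order_trans)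

lemma hausdorff_content_le_outer: "0 < \<delta> \<Longrightarrow> hausdorff_content d \<delta> X \<le> hausdorff_outer d X"
  unfolding hausdorff_outer_def by (intro SUP_upper) auto

lemma hausdorff_outer_mono: "X \<subseteq> Y \<Longrightarrow> hausdorff_outer d X \<le> hausdorff_outer d Y"
  unfolding hausdorff_outer_def by (intro SUP_mono) (auto intro: hausdorff_content_mono)

lemma hausdorff_outer_empty: "hausdorff_outer d {} = 0"
proof -
  have "hausdorff_content d \<delta> ({} :: 'a set) = 0" if "\<delta> > 0" for \<delta>
    using hausdorff_content_le[of "{} :: 'a set" "\<lambda>_. {}" \<delta> d] that by simp
  then show ?thesis unfolding hausdorff_outer_def by simp
qed

lemma hausdorff_content_subadditive:
  fixes X :: "nat \<Rightarrow> 'a::metric_space set"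
  shows "hausdorff_content d \<delta> (\<Union>n. X n) \<le> (\<Sum>n. hausdorff_content d \<delta> (X n))"
proof (cases "\<exists>n. hausdorff_content d \<delta> (X n) = \<infinity>")
  case True
  then obtain n where "hausdorff_content d \<delta> (X n) = \<infinity>" by blast
  then have "(\<Sum>n. hausdorff_content d \<delta> (X n)) = \<infinity>"
    using sum_le_suminf[of "\<lambda>n. hausdorff_content d \<delta> (X n)" "{n}"] by (auto simp: top_unique)
  then show ?thesis by simp
next
  case False
  show ?thesis
  proof (rule ennreal_le_epsilon)
    fix e :: real assume e: "0 < e"
    have "\<exists>C. X n \<subseteq> (\<Union>i. C i) \<and> (\<forall>i. bounded (C i) \<and> diameter (C i) \<le> \<delta>) \<and>
       (\<Sum>i. hausdorff_gauge d (C i)) < hausdorff_content d \<delta> (X n) + ennreal (e * (1/2) ^ Suc n)" for n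
    proof -
      have "hausdorff_content d \<delta> (X n) < hausdorff_content d \<delta> (X n) + ennreal (e * (1/2) ^ Suc n)"
        using False e ennreal_add_left_cancel_less[of "hausdorff_content d \<delta> (X n)" 0 "ennreal (e * (1/2) ^ Suc n)"]
        by (auto simp: less_top top.not_eq_extremum)
      then show ?thesis
        by (subst (asm) hausdorff_content_def) (auto simp: INF_less_iff)
    qed
    then obtain C where C: "\<And>n. X n \<subseteq> (\<Union>i. C n i)" "\<And>n i. bounded (C n i)" "\<And>n i. diameter (C n i) \<le> \<delta>"
      "\<And>n. (\<Sum>i. hausdorff_gauge d (C n i)) < hausdorff_content d \<delta> (X n) + ennreal (e * (1/2) ^ Suc n)"
      by metis
    define D where "D k = (case prod_decode k of (n, i) \<Rightarrow> C n i)" for k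
    have "(\<Union>n. X n) \<subseteq> (\<Union>k. D k)"
    proof
      fix x assume "x \<in> (\<Union>n. X n)"
      then obtain n i where "x \<in> C n i" using C(1) by blast
      then have "x \<in> D (prod_encode (n, i))" by (simp add: D_def)
      then show "x \<in> (\<Union>k. D k)" by blast
    qed
    then have "hausdorff_content d \<delta> (\<Union>n. X n) \<le> (\<Sum>k. hausdorff_gauge d (D k))"
      by (rule hausdorff_content_le) (auto simp: D_def C split: prod.split)
    also have "\<dots> = (\<Sum>n. \<Sum>i. hausdorff_gauge d (C n i))"
      using suminf_ennreal_2dimen[where f="\<lambda>(n,i). hausdorff_gauge d (C n i)"
          and g="\<lambda>n. \<Sum>i. hausdorff_gauge d (C n i)"]
      by (simp add: D_def o_def split: prod.split) (auto simp: prod.case_eq_if)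
    also have "\<dots> \<le> (\<Sum>n. hausdorff_content d \<delta> (X n) + ennreal (e * (1/2) ^ Suc n))"
      using C(4) by (intro suminf_le) (auto intro: less_imp_le)
    also have "\<dots> = (\<Sum>n. hausdorff_content d \<delta> (X n)) + (\<Sum>n. ennreal (e * (1/2) ^ Suc n))"
      by (rule suminf_add[symmetric]) auto
    also have "(\<Sum>n. ennreal (e * (1/2) ^ Suc n)) = ennreal e"
    proof -
      have "(\<lambda>n. e * (1/2) ^ Suc n) sums (e * 1)"
        using power_half_series by (intro sums_mult)
      then show ?thesis using e
        by (intro suminf_ennreal_eq) auto
    qed
    finally show "hausdorff_content d \<delta> (\<Union>n. X n) \<le> (\<Sum>n. hausdorff_content d \<delta> (X n)) + ennreal e" .
  qed
qed

lemma hausdorff_outer_subadditive: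
  "hausdorff_outer d (\<Union>n. X n) \<le> (\<Sum>n. hausdorff_outer d (X n))"
proof -
  have "hausdorff_content d \<delta> (\<Union>n. X n) \<le> (\<Sum>n. hausdorff_outer d (X n))" if "\<delta> > 0" for \<delta>
    by (rule order_trans[OF hausdorff_content_subadditive])
       (use that in \<open>intro suminf_le; simp add: hausdorff_content_le_outer\<close>)
  then show ?thesis
    by (subst hausdorff_outer_def) (auto intro: SUP_least)
qed

lemma outer_measure_space_hausdorff: "outer_measure_space UNIV (hausdorff_outer d)"
  by (auto simp: outer_measure_space_def positive_def increasing_def countably_subadditive_def
      hausdorff_outer_empty hausdorff_outer_mono hausdorff_outer_subadditive)

lemma hausdorff_outer_Un: "hausdorff_outer d (X \<union> Y) \<le> hausdorff_outer d X + hausdorff_outer d Y"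
proof -
  have "hausdorff_outer d (X \<union> Y) = hausdorff_outer d (\<Union>n. case n of 0 \<Rightarrow> X | Suc 0 \<Rightarrow> Y | _ \<Rightarrow> {})"
    by (intro arg_cong[where f="hausdorff_outer d"]) (auto split: nat.splits intro: exI[of _ 0] exI[of _ "Suc 0"])
  also have "\<dots> \<le> (\<Sum>n. hausdorff_outer d (case n of 0 \<Rightarrow> X | Suc 0 \<Rightarrow> Y | _ \<Rightarrow> {}))"
    by (rule hausdorff_outer_subadditive)
  also have "\<dots> = (\<Sum>n\<in>{0, Suc 0}. hausdorff_outer d (case n of 0 \<Rightarrow> X | Suc 0 \<Rightarrow> Y | _ \<Rightarrow> {}))"
    by (rule suminf_finite) (auto simp: hausdorff_outer_empty split: nat.splits)
  finally show ?thesis by simp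
qed

lemma hausdorff_content_separated:
  assumes r: "0 < r" "\<And>x y. x \<in> X \<Longrightarrow> y \<in> Y \<Longrightarrow> r \<le> dist x y" and \<delta>: "0 < \<delta>" "\<delta> < r"
  shows "hausdorff_content d \<delta> X + hausdorff_content d \<delta> Y \<le> hausdorff_content d \<delta> (X \<union> Y)"
proof -
  have "hausdorff_content d \<delta> X + hausdorff_content d \<delta> Y \<le> (\<Sum>i. hausdorff_gauge d (C i))"
    if C: "X \<union> Y \<subseteq> (\<Union>i. C i)" "\<And>i. bounded (C i)" "\<And>i. diameter (C i) \<le> \<delta>" for C
  proof -
    define P where "P i = (if C i \<inter> X \<noteq> {} then C i else {})" for i
    define Q where "Q i = (if C i \<inter> Y \<noteq> {} then C i else {})" for i
    have PQ: "C i \<inter> X = {} \<or> C i \<inter> Y = {}" for i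
    proof (rule ccontr)
      assume "\<not> ?thesis"
      then obtain x y where xy: "x \<in> C i" "x \<in> X" "y \<in> C i" "y \<in> Y" by blast
      have "dist x y \<le> diameter (C i)" using diameter_bounded_bound[OF C(2)] xy by blast
      with r(2)[OF xy(2,4)] C(3)[of i] \<delta> show False by linarith
    qed
    have "hausdorff_content d \<delta> X \<le> (\<Sum>i. hausdorff_gauge d (P i))"
      using C \<delta> by (intro hausdorff_content_le) (fastforce simp: P_def)+
    moreover have "hausdorff_content d \<delta> Y \<le> (\<Sum>i. hausdorff_gauge d (Q i))"
      using C \<delta> by (intro hausdorff_content_le) (fastforce simp: Q_def)+
    ultimately have "hausdorff_content d \<delta> X + hausdorff_content d \<delta> Y
        \<le> (\<Sum>i. hausdorff_gauge d (P i)) + (\<Sum>i. hausdorff_gauge d (Q i))"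
      by (rule add_mono)
    also have "\<dots> = (\<Sum>i. hausdorff_gauge d (P i) + hausdorff_gauge d (Q i))"
      by (rule suminf_add) auto
    also have "\<dots> \<le> (\<Sum>i. hausdorff_gauge d (C i))"
      using PQ by (intro suminf_le) (auto simp: P_def Q_def)
    finally show ?thesis .
  qed
  then show ?thesis
    by (subst (3) hausdorff_content_def) (auto intro!: INF_greatest)
qed

lemma hausdorff_outer_separated:
  assumes r: "0 < r" "\<And>x y. x \<in> X \<Longrightarrow> y \<in> Y \<Longrightarrow> r \<le> dist x y"
  shows "hausdorff_outer d X + hausdorff_outer d Y \<le> hausdorff_outer d (X \<union> Y)"
proof -
  have *: "hausdorff_content d a X + hausdorff_content d b Y \<le> hausdorff_outer d (X \<union> Y)"
    if "0 < a" "0 < b" for a b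
  proof -
    define c where "c = min (min a b) (r/2)"
    have c: "0 < c" "c < r" "c \<le> a" "c \<le> b" using that r by (auto simp: c_def)
    have "hausdorff_content d a X + hausdorff_content d b Y
        \<le> hausdorff_content d c X + hausdorff_content d c Y"
      using c by (intro add_mono hausdorff_content_antimono)
    also have "\<dots> \<le> hausdorff_content d c (X \<union> Y)"
      using c r by (intro hausdorff_content_separated[of r]) auto
    also have "\<dots> \<le> hausdorff_outer d (X \<union> Y)" using c by (intro hausdorff_content_le_outer)
    finally show ?thesis .
  qed
  have "hausdorff_content d a X + hausdorff_outer d Y \<le> hausdorff_outer d (X \<union> Y)" if "0 < a" for a
  proof -
    have "hausdorff_content d a X + hausdorff_outer d Y
        = (SUP b\<in>{0<..}. hausdorff_content d a X + hausdorff_content d b Y)"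
      unfolding hausdorff_outer_def
      using ennreal_SUP_add_left[of "{0<..}" "\<lambda>b. hausdorff_content d b Y" "hausdorff_content d a X"]
      by (simp add: add.commute)
    also have "\<dots> \<le> hausdorff_outer d (X \<union> Y)" using *[OF that] by (intro SUP_least) auto
    finally show ?thesis .
  qed
  moreover have "hausdorff_outer d X + hausdorff_outer d Y
      = (SUP a\<in>{0<..}. hausdorff_content d a X + hausdorff_outer d Y)"
    by (subst hausdorff_outer_def) (rule ennreal_SUP_add_left[symmetric], auto)
  ultimately show ?thesis by (auto intro: SUP_least)
qed

lemma hausdorff_outer_closed:
  fixes F :: "'a::metric_space set"
  assumes F: "closed F"
  shows "hausdorff_outer d (X \<inter> F) + hausdorff_outer d (X - F) \<le> hausdorff_outer d X"
proof (cases "F = {} \<or> hausdorff_outer d X = \<infinity>")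
  case True
  then show ?thesis by (auto simp: hausdorff_outer_empty)
next
  case False
  let ?h = "hausdorff_outer d"
  define B where "B n = {x \<in> X. 1 / real (Suc n) \<le> infdist x F}" for n
  define D where "D n = B (Suc n) - B n" for n
  have BX: "B n \<subseteq> X - F" for n by (auto simp: B_def)
  have Bmono: "B m \<subseteq> B n" if "m \<le> n" for m n
    using that by (auto simp: B_def elim!: order_trans[rotated] intro!: divide_left_mono)
  have BU: "x \<in> (\<Union>n. B n)" if "x \<in> X - F" for x
  proof -
    have "infdist x F > 0" using that F False
      by (metis DiffD2 in_closed_iff_infdist_zero infdist_nonneg order_less_le)
    then obtain n where "inverse (real (Suc n)) < infdist x F" using reals_Archimedean by blast
    then have "x \<in> B n" using that by (auto simp: B_def inverse_eq_divide)
    then show ?thesis by blast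
  qed
  have one: "?h (X \<inter> F) + ?h (B n) \<le> ?h X" for n
  proof -
    have "?h (X \<inter> F) + ?h (B n) \<le> ?h ((X \<inter> F) \<union> B n)"
    proof (rule hausdorff_outer_separated[of "1 / real (Suc n)"])
      fix x y assume "x \<in> X \<inter> F" "y \<in> B n"
      then show "1 / real (Suc n) \<le> dist x y"
        using infdist_le[of x F y] by (auto simp: B_def dist_commute)
    qed simp
    also have "\<dots> \<le> ?h X" using BX by (intro hausdorff_outer_mono) blast
    finally show ?thesis .
  qed
  have sep: "1 / real (Suc (Suc n)) - 1 / real (Suc (Suc (Suc n))) \<le> dist x y"
    if "x \<in> B (Suc n)" "y \<in> D m" "n + 2 \<le> m" for x y m n
  proof -
    have "1 / real (Suc (Suc n)) \<le> infdist x F" using that by (auto simp: B_def)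
    moreover have "infdist y F < 1 / real (Suc m)" using that by (auto simp: D_def B_def)
    moreover have "1 / real (Suc m) \<le> 1 / real (Suc (Suc (Suc n)))"
      using that by (intro divide_left_mono) auto
    moreover have "infdist x F \<le> infdist y F + dist x y" by (rule infdist_triangle)
    ultimately show ?thesis by linarith
  qed
  have part: "(\<Sum>k<N. ?h (D (2 * k + j))) \<le> ?h (\<Union>k<N. D (2 * k + j))" for N j
  proof (induction N)
    case (Suc N)
    have "(\<Sum>k<Suc N. ?h (D (2 * k + j))) \<le> ?h (\<Union>k<N. D (2 * k + j)) + ?h (D (2 * N + j))"
      using Suc by (simp add: add_mono)
    also have "\<dots> \<le> ?h ((\<Union>k<N. D (2 * k + j)) \<union> D (2 * N + j))"
    proof (cases N)
      case 0
      then show ?thesis by (simp add: hausdorff_outer_empty)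
    next
      case (Suc M)
      let ?n = "2 * M + j"
      show ?thesis
      proof (rule hausdorff_outer_separated)
        show "0 < 1 / real (Suc (Suc ?n)) - 1 / real (Suc (Suc (Suc ?n)))"
          by (simp only: diff_gt_0_iff_gt) (rule divide_strict_left_mono, auto)
        fix x y assume x: "x \<in> (\<Union>k<N. D (2 * k + j))" and y: "y \<in> D (2 * N + j)"
        from x obtain k where k: "k < N" "x \<in> D (2 * k + j)" by blast
        have "D (2 * k + j) \<subseteq> B (Suc ?n)"
          using Bmono[of "Suc (2 * k + j)" "Suc ?n"] k Suc by (auto simp: D_def)
        then show "1 / real (Suc (Suc ?n)) - 1 / real (Suc (Suc (Suc ?n))) \<le> dist x y"
          using k y Suc by (intro sep[of x ?n y "2 * N + j"]) auto
      qed
    qed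
    also have "(\<Union>k<N. D (2 * k + j)) \<union> D (2 * N + j) = (\<Union>k<Suc N. D (2 * k + j))"
      by (auto simp: less_Suc_eq)
    finally show ?case .
  qed simp
  have part': "(\<Sum>k<N. ?h (D (2 * k + j))) \<le> ?h X" for N j
    by (rule order_trans[OF part hausdorff_outer_mono]) (use BX in \<open>auto simp: D_def\<close>)
  have split: "(\<Sum>k<2 * N. ?h (D k)) = (\<Sum>k<N. ?h (D (2 * k + 0))) + (\<Sum>k<N. ?h (D (2 * k + 1)))" for N
    by (induction N) (auto simp: algebra_simps)
  have "(\<Sum>k. ?h (D k)) \<le> ?h X + ?h X"
  proof (rule suminf_le_const[OF summableI])
    fix N
    have "(\<Sum>k<N. ?h (D k)) \<le> (\<Sum>k<2 * N. ?h (D k))" by (rule sum_mono2) auto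
    also have "\<dots> \<le> ?h X + ?h X" unfolding split by (intro add_mono part')
    finally show "(\<Sum>k<N. ?h (D k)) \<le> ?h X + ?h X" .
  qed
  then have tot: "(\<Sum>k. ?h (D k)) < \<infinity>"
    using False by (auto simp: less_top[symmetric] top_unique)
  show ?thesis
  proof (rule ennreal_le_epsilon)
    fix e :: real assume e: "0 < e"
    have "\<exists>n. (\<Sum>k. ?h (D k)) \<le> (\<Sum>k<n. ?h (D k)) + ennreal e"
    proof (rule ccontr)
      assume "\<not> ?thesis"
      then have "(\<Sum>k<n. ?h (D k)) + ennreal e \<le> (\<Sum>k. ?h (D k))" for n
        by (meson linear)
      then have "(SUP n. (\<Sum>k<n. ?h (D k)) + ennreal e) \<le> (\<Sum>k. ?h (D k))"
        by (intro SUP_least)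
      then have "(\<Sum>k. ?h (D k)) + ennreal e \<le> (\<Sum>k. ?h (D k))"
        by (simp add: ennreal_SUP_add_left suminf_eq_SUP)
      then have "(\<Sum>k. ?h (D k)) + ennreal e \<le> (\<Sum>k. ?h (D k)) + 0" by simp
      then show False using tot e by (simp only: ennreal_add_left_cancel_le) auto
    qed
    then obtain n where n: "(\<Sum>k. ?h (D k)) \<le> (\<Sum>k<n. ?h (D k)) + ennreal e" by blast
    have "(\<Sum>k. ?h (D k)) = (\<Sum>k<n. ?h (D k)) + (\<Sum>k. ?h (D (k + n)))"
      using suminf_offset[OF summableI, of "\<lambda>k. ?h (D k)" n] by (simp add: add.commute)
    with n have le: "(\<Sum>k<n. ?h (D k)) + (\<Sum>k. ?h (D (k + n))) \<le> (\<Sum>k<n. ?h (D k)) + ennreal e" by simp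
    have "(\<Sum>k<n. ?h (D k)) \<le> (\<Sum>k. ?h (D k))" by (rule sum_le_suminf) auto
    from le_less_trans[OF this tot] have "(\<Sum>k<n. ?h (D k)) \<noteq> \<infinity>" by (metis less_irrefl)
    with le have tail: "(\<Sum>k. ?h (D (k + n))) \<le> ennreal e"
      by (simp only: ennreal_add_left_cancel_le) auto
    have "X - F \<subseteq> B n \<union> (\<Union>k. D (k + n))"
    proof
      fix x assume "x \<in> X - F"
      then obtain m where m: "x \<in> B m" using BU by blast
      define l where "l = (LEAST m. x \<in> B m)"
      have l: "x \<in> B l" unfolding l_def by (rule LeastI[of "\<lambda>m. x \<in> B m", OF m])
      show "x \<in> B n \<union> (\<Union>k. D (k + n))"
      proof (cases "l \<le> n")
        case True
        then show ?thesis using l Bmono by blast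
      next
        case False
        then obtain k where k: "l = Suc (k + n)" by (metis add.commute less_imp_Suc_add not_le)
        have "x \<notin> B (k + n)" using not_less_Least[of "k + n" "\<lambda>m. x \<in> B m"] k by (simp add: l_def[symmetric])
        then have "x \<in> D (k + n)" using l k by (simp add: D_def)
        then show ?thesis by blast
      qed
    qed
    then have "?h (X - F) \<le> ?h (B n \<union> (\<Union>k. D (k + n)))" by (rule hausdorff_outer_mono)
    also have "\<dots> \<le> ?h (B n) + ?h (\<Union>k. D (k + n))" by (rule hausdorff_outer_Un)
    also have "\<dots> \<le> ?h (B n) + ennreal e"
      using order_trans[OF hausdorff_outer_subadditive tail] by (intro add_left_mono)
    finally have "?h (X \<inter> F) + ?h (X - F) \<le> ?h (X \<inter> F) + (?h (B n) + ennreal e)"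
      by (rule add_left_mono)
    also have "\<dots> = (?h (X \<inter> F) + ?h (B n)) + ennreal e" by (simp add: add.assoc)
    also have "\<dots> \<le> ?h X + ennreal e" using one by (intro add_right_mono)
    finally show "?h (X \<inter> F) + ?h (X - F) \<le> ?h X + ennreal e" .
  qed
qed

lemma sets_hausdorff_measure [simp, measurable_cong]: "sets (hausdorff_measure d) = sets borel"
  and space_hausdorff_measure [simp]: "space (hausdorff_measure d) = UNIV"
  by (simp_all add: hausdorff_measure_def sets.sigma_sets_eq[of borel, simplified] )

lemma emeasure_hausdorff_measure:
  assumes X: "X \<in> sets borel"
  shows "emeasure (hausdorff_measure d) X = hausdorff_outer d X"
proof -
  let ?L = "lambda_system UNIV UNIV (hausdorff_outer d :: 'a set \<Rightarrow> ennreal)"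
  interpret U: sigma_algebra "UNIV :: 'a set" "UNIV :: 'a set set"
    using sigma_algebra_Pow[of UNIV] by simp
  have L: "measure_space UNIV ?L (hausdorff_outer d)"
    by (rule U.caratheodory_lemma[OF outer_measure_space_hausdorff])
  then interpret L: sigma_algebra UNIV ?L by (simp add: measure_space_def)
  have closed: "F \<in> ?L" if F: "closed F" for F
  proof -
    have "hausdorff_outer d (Y \<inter> F) + hausdorff_outer d (Y - F) = hausdorff_outer d Y" for Y
      using hausdorff_outer_closed[OF F, of d Y] hausdorff_outer_Un[of d "Y \<inter> F" "Y - F"]
      by (intro antisym) (simp_all add: Int_Diff_Un)
    then show ?thesis by (auto simp: U.lambda_system_eq)
  qed
  have sub: "sets (borel :: 'a measure) \<subseteq> ?L"
    unfolding borel_eq_closed using L.sigma_sets_subset[of "Collect closed"] closed by auto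
  have "countably_additive (sets borel) (hausdorff_outer d :: 'a set \<Rightarrow> ennreal)"
    using L sub unfolding measure_space_def countably_additive_def
    by (meson subset_iff)
  then show ?thesis
    unfolding hausdorff_measure_def using X
    using sets.sigma_algebra_axioms[of "borel :: 'a measure"]
    by (intro emeasure_measure_of_sigma) (auto simp: positive_def hausdorff_outer_empty)
qed


definition surface_measure :: "'a::euclidean_space set \<Rightarrow> 'a measure" where
  "surface_measure \<Omega> = restrict_space (hausdorff_measure (DIM('a) - 1)) (frontier \<Omega>)"

abbreviation surface_integral :: "'a::euclidean_space set \<Rightarrow> ('a \<Rightarrow> real) \<Rightarrow> real" where
  "surface_integral \<Omega> f \<equiv> integral\<^sup>L (surface_measure \<Omega>) f"

text \<open>
  \<open>\<nu>\<close> is the outward unit normal at the boundary point \<open>x\<close>: near \<open>x\<close> and outside any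
  double cone around the tangent plane, the points on the side of \<open>-\<nu>\<close> lie inside and the points on the
  side of \<open>\<nu>\<close> lie outside of \<open>\<Omega>\<close>.
\<close>

definition outward_unit_normal :: "'a::euclidean_space set \<Rightarrow> 'a \<Rightarrow> 'a \<Rightarrow> bool" where
  "outward_unit_normal \<Omega> x \<nu> \<longleftrightarrow> norm \<nu> = 1 \<and>
     (\<forall>\<epsilon>>0. \<exists>r>0. \<forall>y\<in>ball x r.
        (inner (y - x) \<nu> < - \<epsilon> * norm (y - x) \<longrightarrow> y \<in> \<Omega>) \<and>
        (inner (y - x) \<nu> > \<epsilon> * norm (y - x) \<longrightarrow> y \<notin> \<Omega>))"


section \<open>Smooth vector functions\<close>

primrec Ck_on :: "nat \<Rightarrow> 'a::euclidean_space set \<Rightarrow> ('a \<Rightarrow> real) \<Rightarrow> bool" where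
  "Ck_on 0 X f \<longleftrightarrow> continuous_on X f"
| "Ck_on (Suc m) X f \<longleftrightarrow> (\<forall>x\<in>X. f differentiable (at x)) \<and>
     (\<forall>b\<in>Basis. Ck_on m X (\<lambda>x. frechet_derivative f (at x) b))"

definition smooth_field :: "'a::euclidean_space set \<Rightarrow> nat \<Rightarrow> ('a \<Rightarrow> real vec) \<Rightarrow> bool" where
  "smooth_field \<Omega> n F \<longleftrightarrow> (\<forall>x. F x \<in> carrier_vec n) \<and>
     (\<exists>X. open X \<and> closure \<Omega> \<subseteq> X \<and> (\<forall>i<n. \<forall>m. Ck_on m X (\<lambda>x. F x $ i)))"


section \<open>Matrices\<close>

text \<open>
  Matrices with dimensions as values are used because the numbers of positive and of negative
  entries of \<open>\<Lambda>\<close>, hence the sizes of all the blocks, may change from one boundary point to another,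
  and may be zero.
\<close>

text \<open>Only meaningful for non-singular square matrices.\<close>

definition minv :: "real mat \<Rightarrow> real mat" where
  "minv M = the (mat_inverse M)"

definition pos_semidef :: "real mat \<Rightarrow> bool" where
  "pos_semidef M \<longleftrightarrow> square_mat M \<and> transpose_mat M = M \<and>
     (\<forall>v \<in> carrier_vec (dim_row M). 0 \<le> v \<bullet> (M *\<^sub>v v))"

definition pos_def :: "real mat \<Rightarrow> bool" where
  "pos_def M \<longleftrightarrow> square_mat M \<and> transpose_mat M = M \<and>
     (\<forall>v \<in> carrier_vec (dim_row M). v \<noteq> 0\<^sub>v (dim_row M) \<longrightarrow> 0 < v \<bullet> (M *\<^sub>v v))"

definition mat_norm :: "real mat \<Rightarrow> real" where
  "mat_norm M = (SUP v \<in> {v \<in> carrier_vec (dim_col M). v \<bullet> v \<le> 1}. sqrt ((M *\<^sub>v v) \<bullet> (M *\<^sub>v v)))"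

text \<open>These are applied to diagonal matrices only; both keep the zeros off the diagonal.\<close>

abbreviation abs_diag :: "real mat \<Rightarrow> real mat" where
  "abs_diag \<equiv> map_mat abs"

abbreviation sqrt_diag :: "real mat \<Rightarrow> real mat" where
  "sqrt_diag \<equiv> map_mat sqrt"


section \<open>The boundary term\<close>

text \<open>
  All data at one instant of time, on a domain of \<open>\<real>\<^sup>k\<close> represented by a type of class
  \<^class>\<open>euclidean_space\<close> with \<open>Basis\<close> as index set of the coordinate directions.
  The matrices \<open>T\<close>, \<open>\<Lambda>\<close>, \<open>R\<close>, \<open>S\<close>, \<open>\<Sigma>\<close> may depend on the solution: only their values along the
  boundary, for the given \<open>U\<close>, are recorded. The nonlinear case is \<open>coefV p = solU p\<close>.
\<close>

record 'a boundary_data =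
  region :: "'a set"                           \<comment> \<open>\<open>\<Omega>\<close>\<close>
  nrml :: "'a \<Rightarrow> 'a"                           \<comment> \<open>\<open>(n\<^sub>1, \<dots>, n\<^sub>k)\<close>\<close>
  ncomp :: nat                                 \<comment> \<open>\<open>n\<close>\<close>
  fluxA :: "'a \<Rightarrow> real vec \<Rightarrow> real mat"         \<comment> \<open>\<open>A\<^sub>i(V)\<close>, indexed by basis vectors\<close>
  solU :: "'a \<Rightarrow> real vec"
  coefV :: "'a \<Rightarrow> real vec"
  trafoT :: "'a \<Rightarrow> real mat"
  lam :: "'a \<Rightarrow> nat \<Rightarrow> real"                   \<comment> \<open>diagonal entries of \<open>\<Lambda>\<close>\<close>
  bcR :: "'a \<Rightarrow> real mat"
  bcS :: "'a \<Rightarrow> real mat"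
  dataG :: "'a \<Rightarrow> real vec"
  penSigma :: "'a \<Rightarrow> real mat"

definition normal_matrix :: "'a::euclidean_space boundary_data \<Rightarrow> 'a \<Rightarrow> real mat" where
  "normal_matrix p x = mat (ncomp p) (ncomp p)
     (\<lambda>ij. \<Sum>b\<in>Basis. inner (nrml p x) b * (fluxA p b (coefV p x) $$ ij))"

definition Atilde :: "'a::euclidean_space boundary_data \<Rightarrow> 'a \<Rightarrow> real mat" where
  "Atilde p x = (1/2) \<cdot>\<^sub>m (normal_matrix p x + transpose_mat (normal_matrix p x))"

definition varW :: "'a boundary_data \<Rightarrow> 'a \<Rightarrow> real vec" where
  "varW p x = minv (trafoT p x) *\<^sub>v solU p x"

definition Lam :: "'a boundary_data \<Rightarrow> 'a \<Rightarrow> real mat" where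
  "Lam p x = mat_diag (ncomp p) (lam p x)"

definition pos_ind :: "'a boundary_data \<Rightarrow> 'a \<Rightarrow> nat set" where
  "pos_ind p x = {i. i < ncomp p \<and> 0 < lam p x i}"

definition neg_ind :: "'a boundary_data \<Rightarrow> 'a \<Rightarrow> nat set" where
  "neg_ind p x = {i. i < ncomp p \<and> lam p x i < 0}"

definition Jp :: "'a boundary_data \<Rightarrow> 'a \<Rightarrow> real mat" where
  "Jp p x = submatrix (1\<^sub>m (ncomp p)) (pos_ind p x) UNIV"

definition Jm :: "'a boundary_data \<Rightarrow> 'a \<Rightarrow> real mat" where
  "Jm p x = submatrix (1\<^sub>m (ncomp p)) (neg_ind p x) UNIV"

definition Lamp :: "'a boundary_data \<Rightarrow> 'a \<Rightarrow> real mat" where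
  "Lamp p x = submatrix (Lam p x) (pos_ind p x) (pos_ind p x)"

definition Lamm :: "'a boundary_data \<Rightarrow> 'a \<Rightarrow> real mat" where
  "Lamm p x = submatrix (Lam p x) (neg_ind p x) (neg_ind p x)"

definition varWp :: "'a boundary_data \<Rightarrow> 'a \<Rightarrow> real vec" where
  "varWp p x = Jp p x *\<^sub>v varW p x"

definition varWm :: "'a boundary_data \<Rightarrow> 'a \<Rightarrow> real vec" where
  "varWm p x = Jm p x *\<^sub>v varW p x"

definition boundary_term :: "'a::euclidean_space boundary_data \<Rightarrow> real" where
  "boundary_term p = surface_integral (region p) (\<lambda>x. solU p x \<bullet> (Atilde p x *\<^sub>v solU p x))"

definition data_term :: "'a::euclidean_space boundary_data \<Rightarrow> real" where
  "data_term p = surface_integral (region p) (\<lambda>x. dataG p x \<bullet> dataG p x)"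

text \<open>
  The standing assumptions. The normal is only required almost everywhere, so that domains with corners
  are allowed. The two integrability conditions say that the integrals in the statement exist.
\<close>

definition boundary_problem :: "'a::euclidean_space boundary_data \<Rightarrow> bool" where
  "boundary_problem p \<longleftrightarrow>
     open (region p) \<and> connected (region p) \<and> region p \<noteq> {} \<and>
     (AE x in surface_measure (region p). outward_unit_normal (region p) x (nrml p x)) \<and>
     (\<forall>b\<in>Basis. \<forall>v\<in>carrier_vec (ncomp p). fluxA p b v \<in> carrier_mat (ncomp p) (ncomp p)) \<and>
     smooth_field (region p) (ncomp p) (solU p) \<and>
     smooth_field (region p) (ncomp p) (coefV p) \<and>
     (\<forall>x\<in>frontier (region p).
        trafoT p x \<in> carrier_mat (ncomp p) (ncomp p) \<and> invertible_mat (trafoT p x) \<and>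
        solU p x \<bullet> (Atilde p x *\<^sub>v solU p x) = varW p x \<bullet> (Lam p x *\<^sub>v varW p x) \<and>
        bcR p x \<in> carrier_mat (card (neg_ind p x)) (card (pos_ind p x)) \<and>
        bcS p x \<in> carrier_mat (card (neg_ind p x)) (card (neg_ind p x)) \<and> invertible_mat (bcS p x) \<and>
        dataG p x \<in> carrier_vec (card (neg_ind p x))) \<and>
     integrable (surface_measure (region p)) (\<lambda>x. solU p x \<bullet> (Atilde p x *\<^sub>v solU p x)) \<and>
     integrable (surface_measure (region p)) (\<lambda>x. dataG p x \<bullet> dataG p x)"

definition homogeneous :: "'a::euclidean_space boundary_data \<Rightarrow> bool" where
  "homogeneous p \<longleftrightarrow> (\<forall>x\<in>frontier (region p). dataG p x = 0\<^sub>v (card (neg_ind p x)))"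


section \<open>Strong and weak boundary conditions\<close>

definition strongly_imposed :: "'a::euclidean_space boundary_data \<Rightarrow> bool" where
  "strongly_imposed p \<longleftrightarrow> (\<forall>x\<in>frontier (region p).
     varWm p x = bcR p x *\<^sub>v varWp p x + minv (bcS p x) *\<^sub>v dataG p x)"

text \<open>
  The lifting operator turns a field \<open>\<Psi>\<close> on the boundary into a distribution \<open>L\<^sub>C(\<Psi>)\<close> on the domain; no
  function on \<open>\<Omega>\<close> has the defining property for all test functions. It is therefore represented
  by the functional \<open>\<Phi> \<mapsto> \<integral>\<^sub>\<Omega> \<Phi>\<^sup>T L\<^sub>C(\<Psi>) d\<Omega>\<close>, which is \<open>\<Phi> \<mapsto> \<integral> \<Phi>\<^sup>T \<Psi> ds\<close> over the boundary.
\<close>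

definition lifting :: "'a::euclidean_space set \<Rightarrow> ('a \<Rightarrow> real vec) \<Rightarrow> ('a \<Rightarrow> real vec) \<Rightarrow> real" where
  "lifting \<Omega> \<Psi> \<Phi> = surface_integral \<Omega> (\<lambda>x. \<Phi> x \<bullet> \<Psi> x)"

definition bc_residual :: "'a boundary_data \<Rightarrow> 'a \<Rightarrow> real vec" where
  "bc_residual p x = varWm p x - bcR p x *\<^sub>v varWp p x - minv (bcS p x) *\<^sub>v dataG p x"

definition penalty :: "'a boundary_data \<Rightarrow> 'a \<Rightarrow> real vec" where
  "penalty p x = 2 \<cdot>\<^sub>v
     (transpose_mat (Jm p x * minv (trafoT p x)) *\<^sub>v (penSigma p x *\<^sub>v bc_residual p x))"

definition weakly_imposed :: "'a::euclidean_space boundary_data \<Rightarrow> bool" where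
  "weakly_imposed p \<longleftrightarrow>
     (\<forall>x\<in>frontier (region p). penSigma p x \<in> carrier_mat (card (neg_ind p x)) (card (neg_ind p x))) \<and>
     integrable (surface_measure (region p)) (\<lambda>x. solU p x \<bullet> penalty p x)"

text \<open>
  What the differential equation with the lifting term on its left-hand side contributes on the boundary
  when it is multiplied by \<open>U\<^sup>T\<close> and integrated over the domain.
\<close>

definition weak_boundary_term :: "'a::euclidean_space boundary_data \<Rightarrow> real" where
  "weak_boundary_term p = boundary_term p + lifting (region p) (penalty p) (solU p)"


section \<open>Conditions on the matrices\<close>

definition schur_R :: "'a boundary_data \<Rightarrow> 'a \<Rightarrow> real mat" where
  "schur_R p x = Lamp p x - transpose_mat (bcR p x) * abs_diag (Lamm p x) * bcR p x"

definition cond_I :: "'a::euclidean_space boundary_data \<Rightarrow> bool" where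
  "cond_I p \<longleftrightarrow> (\<forall>x\<in>frontier (region p). pos_semidef (schur_R p x))"

definition cond_I_strict :: "'a::euclidean_space boundary_data \<Rightarrow> bool" where
  "cond_I_strict p \<longleftrightarrow> (\<forall>x\<in>frontier (region p). pos_def (schur_R p x))"

text \<open>
  The size of \<open>St\<close> is controlled by a threshold \<open>\<delta>\<close> that sees only \<open>\<Lambda>\<^sup>+\<close>, \<open>\<Lambda>\<^sup>-\<close> and \<open>R\<close> at
  the boundary point; it is to be chosen before the domain, the solution, \<open>S\<close> and the data.
\<close>

definition cond_II :: "(real mat \<Rightarrow> real mat \<Rightarrow> real mat \<Rightarrow> real) \<Rightarrow> 'a::euclidean_space boundary_data \<Rightarrow> bool" where
  "cond_II \<delta> p \<longleftrightarrow> (\<forall>x\<in>frontier (region p).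
     \<exists>St \<in> carrier_mat (card (neg_ind p x)) (card (neg_ind p x)).
       invertible_mat St \<and> bcS p x = minv St * sqrt_diag (abs_diag (Lamm p x)) \<and>
       mat_norm St \<le> \<delta> (Lamp p x) (Lamm p x) (bcR p x))"

definition cond_III :: "'a::euclidean_space boundary_data \<Rightarrow> bool" where
  "cond_III p \<longleftrightarrow> (\<forall>x\<in>frontier (region p). penSigma p x = abs_diag (Lamm p x))"

end

theory Submission
  imports Defs "Jordan_Normal_Form.Determinant"
begin

text \<open>
  All four bounds hold pointwise on the boundary, and all four follow from one identity. Put
  \<open>D = |\<Lambda>\<^sup>-|\<close>, \<open>g = S\<inverse>G\<close>, \<open>r = W\<^sup>- - R W\<^sup>+ - g\<close> (the residual of the boundary condition) and
  \<open>A = \<Lambda>\<^sup>+ - R\<^sup>T D R\<close>. Substituting \<open>W\<^sup>- = R W\<^sup>+ + g + r\<close> makes the terms linear in \<open>r\<close> cancel: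

  \<open>W\<^sup>T \<Lambda> W + 2 (W\<^sup>-)\<^sup>T D r =
      (W\<^sup>+)\<^sup>T A W\<^sup>+ - 2 (R W\<^sup>+)\<^sup>T D g - g\<^sup>T D g + r\<^sup>T D r\<close>.

  The left-hand side is the weak boundary density for the penalty matrix \<open>\<Sigma> = D\<close>. It is also the
  strong boundary density, because there \<open>r = 0\<close>. So the weak imposition differs from the strong
  one only by the dissipation \<open>r\<^sup>T D r \<ge> 0\<close>, and one lower bound serves both
  (\<open>boundary_energy_identity\<close>). For \<open>G = 0\<close> also \<open>g = 0\<close>, and what remains is
  \<open>(W\<^sup>+)\<^sup>T A W\<^sup>+ + r\<^sup>T D r\<close>, which is nonnegative by condition (I).

  For \<open>G \<noteq> 0\<close> the mixed term has to be absorbed. Since \<open>A\<close> is positive definite, there is \<open>K > 0\<close>,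
  determined by \<open>\<Lambda>\<^sup>+\<close>, \<open>\<Lambda>\<^sup>-\<close> and \<open>R\<close>, with \<open>x\<^sup>T R\<^sup>T D R x \<le> K x\<^sup>T A x\<close> for all \<open>x\<close>
  (\<open>pos_def_dominates\<close>). Young's inequality with weight \<open>K\<close> bounds the density below by
  \<open>- (1 + K) g\<^sup>T D g\<close> (\<open>data_lower_bound\<close>). Condition (II) is chosen so that
  \<open>D\<^sup>1\<^sup>/\<^sup>2 g = St G\<close> (\<open>scaled_data\<close>), hence \<open>g\<^sup>T D g \<le> \<parallel>St\<parallel>\<^sup>2 G\<^sup>T G\<close>, and
  \<open>\<parallel>St\<parallel> \<le> 1 / sqrt (1 + K)\<close> is small enough.
\<close>

section \<open>Quadratic forms\<close>

lemma pos_def_carrier: "pos_def A \<Longrightarrow> A \<in> carrier_mat (dim_row A) (dim_row A)"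
  by (auto simp: pos_def_def)

lemma pos_semidef_nonneg:
  "pos_semidef A \<Longrightarrow> A \<in> carrier_mat n n \<Longrightarrow> x \<in> carrier_vec n \<Longrightarrow> 0 \<le> x \<bullet> (A *\<^sub>v x)"
  by (auto simp: pos_semidef_def)

lemma pos_def_imp_pos_semidef:
  assumes "pos_def A"
  shows "pos_semidef A"
  unfolding pos_semidef_def
proof (intro conjI ballI)
  show "square_mat A" "transpose_mat A = A" using assms by (auto simp: pos_def_def)
  fix v :: "real vec" assume v: "v \<in> carrier_vec (dim_row A)"
  show "0 \<le> v \<bullet> (A *\<^sub>v v)"
  proof (cases "v = 0\<^sub>v (dim_row A)")
    case True
    then show ?thesis using pos_def_carrier[OF assms] by (metis mult_mat_vec_carrier order_refl scalar_prod_left_zero v)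
  next
    case False
    then show ?thesis using assms v by (force simp: pos_def_def)
  qed
qed

lemma symmetric_bilinear:
  fixes A :: "'a::comm_ring mat"
  assumes "A \<in> carrier_mat n n" "transpose_mat A = A" "x \<in> carrier_vec n" "y \<in> carrier_vec n"
  shows "x \<bullet> (A *\<^sub>v y) = y \<bullet> (A *\<^sub>v x)"
proof -
  have "x \<bullet> (A *\<^sub>v y) = (A *\<^sub>v x) \<bullet> y"
    using transpose_vec_mult_scalar[of A n n y x] assms by simp
  then show ?thesis using assms comm_scalar_prod[of "A *\<^sub>v x" n y] by simp
qed

text \<open>
  The usual argument for the inner product \<open>x\<^sup>T A y\<close>: the form is nonnegative at the difference of
  \<open>x\<close> and its projection to \<open>y\<close>.
\<close>

lemma pos_def_Cauchy_Schwarz: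
  assumes A: "pos_def A" "A \<in> carrier_mat n n" and x: "x \<in> carrier_vec n" and y: "y \<in> carrier_vec n"
  shows "(x \<bullet> (A *\<^sub>v y))\<^sup>2 \<le> (x \<bullet> (A *\<^sub>v x)) * (y \<bullet> (A *\<^sub>v y))"
proof (cases "y = 0\<^sub>v n")
  case True
  have "A *\<^sub>v 0\<^sub>v n = 0\<^sub>v n" using A by auto
  then show ?thesis using True x by simp
next
  case False
  define a b c where "a = x \<bullet> (A *\<^sub>v x)" and "b = x \<bullet> (A *\<^sub>v y)" and "c = y \<bullet> (A *\<^sub>v y)"
  have c: "0 < c" using A y False by (auto simp: pos_def_def c_def)
  have sym: "y \<bullet> (A *\<^sub>v x) = b"
    unfolding b_def using A x y by (intro symmetric_bilinear) (auto simp: pos_def_def)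
  define z where "z = x + (- b / c) \<cdot>\<^sub>v y"
  have z: "z \<in> carrier_vec n" using x y by (simp add: z_def)
  have Ax: "A *\<^sub>v x \<in> carrier_vec n" "A *\<^sub>v y \<in> carrier_vec n" using A x y by auto
  have "A *\<^sub>v z = A *\<^sub>v x + (- b / c) \<cdot>\<^sub>v (A *\<^sub>v y)"
    using A x y by (simp add: z_def mult_add_distrib_mat_vec[of _ n n] mult_mat_vec[of _ n n])
  then have "z \<bullet> (A *\<^sub>v z) = a + 2 * (- b / c) * b + (- b / c)\<^sup>2 * c"
    using x y Ax sym
    by (simp add: z_def add_scalar_prod_distrib[of _ n] scalar_prod_add_distrib[of _ n]
        a_def[symmetric] b_def[symmetric] c_def[symmetric] power2_eq_square)
  also have "\<dots> = a - b\<^sup>2 / c" using c by (simp add: field_simps power2_eq_square)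
  finally have "0 \<le> a - b\<^sup>2 / c"
    using pos_semidef_nonneg[OF pos_def_imp_pos_semidef[OF A(1)] A(2) z] by simp
  then show ?thesis using c by (simp add: a_def[symmetric] b_def[symmetric] c_def[symmetric] field_simps)
qed

text \<open>A positive definite matrix has trivial kernel, hence non-zero determinant.\<close>

lemma pos_def_surj:
  assumes A: "pos_def A" "A \<in> carrier_mat n n" and r: "r \<in> carrier_vec n"
  obtains s where "s \<in> carrier_vec n" "A *\<^sub>v s = r"
proof -
  have "v \<bullet> (A *\<^sub>v v) \<noteq> 0" if "v \<in> carrier_vec n" "v \<noteq> 0\<^sub>v n" for v
    using A that by (force simp: pos_def_def)
  then have "det A \<noteq> 0"
    using det_0_iff_vec_prod_zero[OF A(2)] by (metis scalar_prod_right_zero)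
  from det_non_zero_imp_unit[OF A(2) this, of "()"] obtain B
    where B: "B \<in> carrier_mat n n" "A * B = 1\<^sub>m n"
    by (auto simp: Units_def ring_mat_def)
  then have "A *\<^sub>v (B *\<^sub>v r) = r" using A r by (metis assoc_mult_mat_vec one_mult_mat_vec)
  then show ?thesis using B r by (intro that[of "B *\<^sub>v r"]) auto
qed

text \<open>
  A constructive replacement for compactness of the unit sphere: each row of \<open>E\<close> is \<open>A s\<^sub>i\<close> for
  some \<open>s\<^sub>i\<close>, so the Cauchy-Schwarz inequality for \<open>A\<close> bounds each component of \<open>E x\<close> and
  \<open>\<Sum>\<^sub>i s\<^sub>i\<^sup>T A s\<^sub>i\<close> serves as the constant.
\<close>

lemma pos_def_dominates:
  assumes A: "pos_def A" "A \<in> carrier_mat n n" and E: "E \<in> carrier_mat m n"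
  obtains K where "0 < K" "\<And>x. x \<in> carrier_vec n \<Longrightarrow> (E *\<^sub>v x) \<bullet> (E *\<^sub>v x) \<le> K * (x \<bullet> (A *\<^sub>v x))"
proof -
  have "\<exists>s. s \<in> carrier_vec n \<and> A *\<^sub>v s = Matrix.row E i" if "i < m" for i
    using pos_def_surj[OF A, of "Matrix.row E i"] E that by auto
  then obtain s where s: "\<And>i. i < m \<Longrightarrow> s i \<in> carrier_vec n" "\<And>i. i < m \<Longrightarrow> A *\<^sub>v s i = Matrix.row E i" by metis
  \<comment> \<open>The summand 1 makes the constant positive also for \<open>E = 0\<close>.\<close>
  let ?K = "1 + (\<Sum>i<m. s i \<bullet> (A *\<^sub>v s i))"
  have nn: "0 \<le> x \<bullet> (A *\<^sub>v x)" if "x \<in> carrier_vec n" for x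
    using pos_semidef_nonneg[OF pos_def_imp_pos_semidef] A that by blast
  show ?thesis
  proof (rule that[of ?K])
    show "0 < ?K" using s(1) nn by (intro add_pos_nonneg sum_nonneg) auto
    fix x :: "real vec" assume x: "x \<in> carrier_vec n"
    have "(E *\<^sub>v x) \<bullet> (E *\<^sub>v x) = (\<Sum>i<m. (Matrix.row E i \<bullet> x)\<^sup>2)"
      using E by (auto simp: scalar_prod_def[of "E *\<^sub>v x"] power2_eq_square atLeast0LessThan intro!: sum.cong)
    also have "\<dots> \<le> (\<Sum>i<m. (x \<bullet> (A *\<^sub>v x)) * (s i \<bullet> (A *\<^sub>v s i)))"
    proof (rule sum_mono)
      fix i assume "i \<in> {..<m}"
      then have i: "i < m" by simp
      have "Matrix.row E i \<bullet> x = x \<bullet> (A *\<^sub>v s i)" using s(2)[OF i] E x i by (metis comm_scalar_prod row_carrier_vec)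
      then show "(Matrix.row E i \<bullet> x)\<^sup>2 \<le> (x \<bullet> (A *\<^sub>v x)) * (s i \<bullet> (A *\<^sub>v s i))"
        using pos_def_Cauchy_Schwarz[OF A x s(1)[OF i]] by simp
    qed
    also have "\<dots> = (\<Sum>i<m. s i \<bullet> (A *\<^sub>v s i)) * (x \<bullet> (A *\<^sub>v x))" by (simp add: sum_distrib_left mult.commute)
    also have "\<dots> \<le> ?K * (x \<bullet> (A *\<^sub>v x))" using nn[OF x] by (intro mult_right_mono) auto
    finally show "(E *\<^sub>v x) \<bullet> (E *\<^sub>v x) \<le> ?K * (x \<bullet> (A *\<^sub>v x))" .
  qed
qed


section \<open>The operator norm\<close>

lemma scalar_prod_self_nonneg: "0 \<le> (v :: real vec) \<bullet> v"
  by (simp add: scalar_prod_def sum_nonneg)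

text \<open>
  A supremum of reals bounds its family only if that is bounded; the Frobenius norm is an upper bound.
\<close>

lemma mat_norm_image_bdd:
  "bdd_above ((\<lambda>v. sqrt ((M *\<^sub>v v) \<bullet> (M *\<^sub>v v))) ` {v \<in> carrier_vec (dim_col M). v \<bullet> v \<le> 1})"
proof (rule bdd_aboveI2)
  fix v :: "real vec" assume "v \<in> {v \<in> carrier_vec (dim_col M). v \<bullet> v \<le> 1}"
  then have v: "v \<in> carrier_vec (dim_col M)" "v \<bullet> v \<le> 1" by auto
  have "(M *\<^sub>v v) \<bullet> (M *\<^sub>v v) = (\<Sum>i<dim_row M. (Matrix.row M i \<bullet> v)\<^sup>2)"
    by (auto simp: scalar_prod_def[of "M *\<^sub>v v"] power2_eq_square atLeast0LessThan intro!: sum.cong)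
  also have "\<dots> \<le> (\<Sum>i<dim_row M. Matrix.row M i \<bullet> Matrix.row M i)"
  proof (rule sum_mono)
    fix i
    have "(Matrix.row M i \<bullet> v)\<^sup>2 \<le> (Matrix.row M i \<bullet> Matrix.row M i) * (v \<bullet> v)"
      using Cauchy_Schwarz_ineq_sum[of "\<lambda>j. Matrix.row M i $ j" "\<lambda>j. v $ j" "{0..<dim_col M}"] v
      by (simp add: scalar_prod_def power2_eq_square)
    also have "\<dots> \<le> Matrix.row M i \<bullet> Matrix.row M i"
      using v scalar_prod_self_nonneg[of "Matrix.row M i"] by (simp add: mult_left_le)
    finally show "(Matrix.row M i \<bullet> v)\<^sup>2 \<le> Matrix.row M i \<bullet> Matrix.row M i" .
  qed
  finally show "sqrt ((M *\<^sub>v v) \<bullet> (M *\<^sub>v v)) \<le> sqrt (\<Sum>i<dim_row M. Matrix.row M i \<bullet> Matrix.row M i)" by simp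
qed

lemma mat_norm_bound:
  assumes M: "M \<in> carrier_mat m n" and v: "v \<in> carrier_vec n"
  shows "(M *\<^sub>v v) \<bullet> (M *\<^sub>v v) \<le> (mat_norm M)\<^sup>2 * (v \<bullet> v)"
proof (cases "v \<bullet> v = 0")
  case True
  then have "v $ i = 0" if "i < n" for i
    using v that by (auto simp: scalar_prod_def sum_nonneg_eq_0_iff)
  then have "v = 0\<^sub>v n" using v by (intro eq_vecI) auto
  then have "M *\<^sub>v v = 0\<^sub>v m" using M by auto
  then show ?thesis using True by simp
next
  case False
  define c where "c = sqrt (v \<bullet> v)"
  have c: "0 < c" "c\<^sup>2 = v \<bullet> v" using False scalar_prod_self_nonneg[of v] by (auto simp: c_def)
  define u where "u = (1 / c) \<cdot>\<^sub>v v"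
  have u: "u \<in> carrier_vec n" "v = c \<cdot>\<^sub>v u" using c v by (auto simp: u_def smult_smult_assoc)
  have "u \<bullet> u = 1" using v c(1) unfolding u_def by (simp add: c(2)[symmetric] power2_eq_square)
  then have "sqrt ((M *\<^sub>v u) \<bullet> (M *\<^sub>v u)) \<le> mat_norm M"
    unfolding mat_norm_def using M u by (intro cSUP_upper mat_norm_image_bdd) auto
  then have "(M *\<^sub>v u) \<bullet> (M *\<^sub>v u) \<le> (mat_norm M)\<^sup>2" by (rule sqrt_le_D)
  then have "c\<^sup>2 * ((M *\<^sub>v u) \<bullet> (M *\<^sub>v u)) \<le> c\<^sup>2 * (mat_norm M)\<^sup>2" by (intro mult_left_mono) auto
  moreover have "(M *\<^sub>v v) \<bullet> (M *\<^sub>v v) = c\<^sup>2 * ((M *\<^sub>v u) \<bullet> (M *\<^sub>v u))"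
    unfolding u(2) using M u(1) by (simp add: mult_mat_vec[of _ m n] power2_eq_square)
  ultimately show ?thesis using c by (simp add: mult.commute)
qed

lemma mat_norm_nonneg: "0 \<le> mat_norm M"
proof -
  have "0 \<le> sqrt ((M *\<^sub>v 0\<^sub>v (dim_col M)) \<bullet> (M *\<^sub>v 0\<^sub>v (dim_col M)))"
    using scalar_prod_self_nonneg by simp
  also have "\<dots> \<le> mat_norm M"
    unfolding mat_norm_def by (intro cSUP_upper mat_norm_image_bdd) auto
  finally show ?thesis .
qed


section \<open>Inverses and diagonal blocks\<close>

lemma minv:
  assumes M: "M \<in> carrier_mat n n" "invertible_mat M"
  shows minv_carrier: "minv M \<in> carrier_mat n n"
    and minv_right: "M * minv M = 1\<^sub>m n"
    and minv_left: "minv M * M = 1\<^sub>m n"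
proof -
  obtain B where B: "M * B = 1\<^sub>m n" "B * M = 1\<^sub>m (dim_row B)"
    using M unfolding invertible_mat_def inverts_mat_def carrier_mat_def by blast
  have "dim_col B = n" using arg_cong[OF B(1), of dim_col] by simp
  moreover have "dim_row B = n" using arg_cong[OF B(2), of dim_col] M by simp
  ultimately have "M \<in> Units (ring_mat TYPE(real) n ())"
    using M B by (auto simp: Units_def ring_mat_def)
  then obtain C where C: "mat_inverse M = Some C"
    using mat_inverse(1)[OF M(1), where b = "()"] by (cases "mat_inverse M") auto
  then show "minv M \<in> carrier_mat n n" "M * minv M = 1\<^sub>m n" "minv M * M = 1\<^sub>m n"
    using mat_inverse(2)[OF M(1) C] by (auto simp: minv_def)
qed

lemma minv_solve:
  assumes M: "M \<in> carrier_mat n n" "invertible_mat M" and "x \<in> carrier_vec n" "y \<in> carrier_vec n"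
  shows "M *\<^sub>v x = y \<longleftrightarrow> x = minv M *\<^sub>v y"
  using assms minv[OF M] by (metis assoc_mult_mat_vec one_mult_mat_vec)

text \<open>
  Reindexing along this bijection turns a sum over the entries of a block into a sum over the
  selected indices, so that the two blocks can be added up to the full diagonal form.
\<close>

lemma bij_betw_pick:
  assumes "finite I"
  shows "bij_betw (pick I) {..<card I} I"
  unfolding bij_betw_def
proof
  show "inj_on (pick I) {..<card I}"
    by (rule inj_onI) (metis card_pick lessThan_iff)
  then have "card (pick I ` {..<card I}) = card I" by (simp add: card_image)
  then show "pick I ` {..<card I} = I"
    using assms by (intro card_subset_eq) (auto intro: pick_in_set)
qed

lemma submatrix_one_mult_vec:
  assumes "I \<subseteq> {..<n}" "w \<in> carrier_vec n"
  shows "submatrix (1\<^sub>m n) I UNIV *\<^sub>v (w :: real vec) = Matrix.vec (card I) (\<lambda>k. w $ pick I k)"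
proof -
  have I: "{i. i < n \<and> i \<in> I} = I" using assms by auto
  have p: "pick I k < n" if "k < card I" for k using assms(1) pick_in_set[of k I] that by auto
  have "Matrix.row (submatrix (1\<^sub>m n :: real mat) I UNIV) k = unit_vec n (pick I k)" if "k < card I" for k
    using p[OF that] that by (intro eq_vecI) (auto simp: submatrix_def I pick_UNIV unit_vec_def)
  then show ?thesis
    using p assms by (intro eq_vecI) (auto simp: dim_submatrix I)
qed

lemma submatrix_mat_diag:
  assumes "I \<subseteq> {..<n}"
  shows "submatrix (mat_diag n d) I I = mat_diag (card I) (\<lambda>k. d (pick I k))"
proof -
  have I: "{i. i < n \<and> i \<in> I} = I" using assms by auto
  have p: "pick I k < n" if "k < card I" for k using assms(1) pick_in_set[of k I] that by auto
  have inj: "pick I k = pick I l \<longleftrightarrow> k = l" if "k < card I" "l < card I" for k l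
    using that by (metis card_pick)
  show ?thesis
    by (rule eq_matI) (auto simp: submatrix_def mat_diag_def I p inj)
qed

lemma mat_diag_quadratic:
  assumes "w \<in> carrier_vec n"
  shows "w \<bullet> (mat_diag n d *\<^sub>v (w :: real vec)) = (\<Sum>i<n. d i * (w $ i)\<^sup>2)"
proof -
  have "mat_diag n d *\<^sub>v w = Matrix.vec n (\<lambda>i. d i * w $ i)"
  proof (rule eq_vecI)
    fix i assume "i < dim_vec (Matrix.vec n (\<lambda>i. d i * w $ i))"
    then have i: "i < n" by simp
    have "Matrix.row (mat_diag n d) i = d i \<cdot>\<^sub>v unit_vec n i"
      using i by (intro eq_vecI) (auto simp: mat_diag_def)
    then show "(mat_diag n d *\<^sub>v w) $ i = Matrix.vec n (\<lambda>i. d i * w $ i) $ i"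
      using i assms by (simp add: mat_diag_def)
  qed (simp add: mat_diag_def)
  then show ?thesis
    using assms by (simp add: scalar_prod_def atLeast0LessThan power2_eq_square algebra_simps)
qed

lemma block_quadratic:
  assumes "I \<subseteq> {..<n}" "w \<in> carrier_vec n"
  defines "z \<equiv> submatrix (1\<^sub>m n) I UNIV *\<^sub>v (w :: real vec)"
  shows "z \<bullet> (submatrix (mat_diag n d) I I *\<^sub>v z) = (\<Sum>i\<in>I. d i * (w $ i)\<^sup>2)"
proof -
  have z: "z = Matrix.vec (card I) (\<lambda>k. w $ pick I k)"
    unfolding z_def using assms(1,2) by (rule submatrix_one_mult_vec)
  have "finite I" using assms(1) finite_subset by blast
  have "z \<bullet> (submatrix (mat_diag n d) I I *\<^sub>v z) = (\<Sum>k<card I. d (pick I k) * (w $ pick I k)\<^sup>2)"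
    using assms(1) by (simp add: submatrix_mat_diag mat_diag_quadratic z)
  also have "\<dots> = (\<Sum>i\<in>I. d i * (w $ i)\<^sup>2)"
    by (rule sum.reindex_bij_betw[OF bij_betw_pick[OF \<open>finite I\<close>]])
  finally show ?thesis .
qed

lemma map_mat_diag: "f 0 = 0 \<Longrightarrow> map_mat f (mat_diag n d) = mat_diag n (\<lambda>i. f (d i))"
  by (rule eq_matI) (auto simp: mat_diag_def)

lemma transpose_mat_diag: "transpose_mat (mat_diag n d) = mat_diag n d"
  by (rule eq_matI) (auto simp: mat_diag_def)


section \<open>The energy identity\<close>

text \<open>
  The factorisation \<open>|\<Lambda>\<^sup>-| = Q Q\<close> with symmetric \<open>Q\<close> turns every term with \<open>|\<Lambda>\<^sup>-|\<close> into a plain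
  inner product. With \<open>a = Q R P\<close>, \<open>b = Q g\<close>, \<open>c = Q r\<close> the identity is
  \<open>- |a + b + c|\<^sup>2 + 2 (a + b + c)\<^sup>T c = - |a + b|\<^sup>2 + |c|\<^sup>2\<close>, where \<open>- |a|\<^sup>2\<close> is absorbed in the
  Schur-type matrix.
\<close>

lemma energy_identity:
  fixes Q :: "real mat"
  assumes Q: "Q \<in> carrier_mat m m" "transpose_mat Q = Q"
    and L: "L \<in> carrier_mat n n" and R: "R \<in> carrier_mat m n"
    and P: "P \<in> carrier_vec n" and M: "M \<in> carrier_vec m" and g: "g \<in> carrier_vec m"
  defines "r \<equiv> M - R *\<^sub>v P - g"
  shows "P \<bullet> (L *\<^sub>v P) - M \<bullet> ((Q * Q) *\<^sub>v M) + 2 * (M \<bullet> ((Q * Q) *\<^sub>v r)) =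
     P \<bullet> ((L - transpose_mat R * (Q * Q) * R) *\<^sub>v P)
       - 2 * (((Q * R) *\<^sub>v P) \<bullet> (Q *\<^sub>v g)) - (Q *\<^sub>v g) \<bullet> (Q *\<^sub>v g) + (Q *\<^sub>v r) \<bullet> (Q *\<^sub>v r)"
proof -
  have QQ: "u \<bullet> ((Q * Q) *\<^sub>v v) = (Q *\<^sub>v u) \<bullet> (Q *\<^sub>v v)" if "u \<in> carrier_vec m" "v \<in> carrier_vec m" for u v
    using Q that transpose_vec_mult_scalar[of Q m m "Q *\<^sub>v v" u] by simp
  define a b c where "a = Q *\<^sub>v (R *\<^sub>v P)" and "b = Q *\<^sub>v g" and "c = Q *\<^sub>v r"
  have abc: "a \<in> carrier_vec m" "b \<in> carrier_vec m" "c \<in> carrier_vec m"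
    using assms by (auto simp: a_def b_def c_def)
  have r: "r \<in> carrier_vec m" and RP: "R *\<^sub>v P \<in> carrier_vec m" using assms by auto
  have "M = R *\<^sub>v P + g + r" using M g R unfolding r_def by (intro eq_vecI) auto
  then have QM: "Q *\<^sub>v M = a + b + c"
    using Q r RP g abc[unfolded a_def b_def c_def]
    by (simp add: a_def b_def c_def mult_add_distrib_mat_vec[of _ m m] assoc_add_vec[of _ m])
  have "P \<bullet> ((transpose_mat R * (Q * Q) * R) *\<^sub>v P) = P \<bullet> (transpose_mat R *\<^sub>v ((Q * Q) *\<^sub>v (R *\<^sub>v P)))"
    using Q R P assoc_mult_mat_vec[of "transpose_mat R" n m "Q * Q" m "R *\<^sub>v P"]
    by (subst assoc_mult_mat_vec[of _ n m _ n]) auto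
  also have "\<dots> = (transpose_mat R *\<^sub>v ((Q * Q) *\<^sub>v (R *\<^sub>v P))) \<bullet> P"
    using Q R P by (intro comm_scalar_prod[of _ n]) auto
  also have "\<dots> = ((Q * Q) *\<^sub>v (R *\<^sub>v P)) \<bullet> (R *\<^sub>v P)"
    using Q R P by (intro transpose_vec_mult_scalar[of _ m n]) auto
  also have "\<dots> = (R *\<^sub>v P) \<bullet> ((Q * Q) *\<^sub>v (R *\<^sub>v P))"
    using Q R P by (intro comm_scalar_prod[of _ m]) auto
  also have "\<dots> = a \<bullet> a" using RP by (simp only: QQ a_def)
  finally have aa: "P \<bullet> ((transpose_mat R * (Q * Q) * R) *\<^sub>v P) = a \<bullet> a" .
  have RQR: "transpose_mat R * (Q * Q) * R \<in> carrier_mat n n" using Q R by auto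
  have "P \<bullet> ((L - transpose_mat R * (Q * Q) * R) *\<^sub>v P) = P \<bullet> (L *\<^sub>v P) - a \<bullet> a"
    unfolding aa[symmetric] minus_mult_distrib_mat_vec[OF L RQR P]
    using L RQR P by (intro scalar_prod_minus_distrib[of _ n]) auto
  moreover have "(Q * R) *\<^sub>v P = a" using Q R P by (simp add: a_def)
  moreover have "M \<bullet> ((Q * Q) *\<^sub>v M) = (a + b + c) \<bullet> (a + b + c)"
    "M \<bullet> ((Q * Q) *\<^sub>v r) = (a + b + c) \<bullet> c"
    using QQ[OF M M] QQ[OF M r] by (auto simp: QM c_def)
  moreover have "b \<bullet> a = a \<bullet> b" "c \<bullet> a = a \<bullet> c" "c \<bullet> b = b \<bullet> c"
    using abc by (auto intro: comm_scalar_prod)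
  ultimately show ?thesis
    using abc unfolding b_def[symmetric] c_def[symmetric]
    by (simp add: add_scalar_prod_distrib[of _ m] scalar_prod_add_distrib[of _ m])
qed

text \<open>Young's inequality \<open>2 u\<^sup>T v \<le> |u|\<^sup>2 / K + K |v|\<^sup>2\<close>, from the square of \<open>u - K v\<close>.\<close>

lemma data_lower_bound:
  fixes u v :: "real vec"
  assumes K: "0 < K" "u \<bullet> u \<le> K * q" and d: "(1 + K) * (v \<bullet> v) \<le> e"
    and uv: "u \<in> carrier_vec m" "v \<in> carrier_vec m"
  shows "- e \<le> q - 2 * (u \<bullet> v) - v \<bullet> v"
proof -
  define w where "w = u - K \<cdot>\<^sub>v v"
  have "w \<bullet> w = u \<bullet> u - 2 * K * (u \<bullet> v) + K * K * (v \<bullet> v)"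
    using uv comm_scalar_prod[of v m u]
    by (simp add: w_def minus_scalar_prod_distrib[of _ m] scalar_prod_minus_distrib[of _ m] algebra_simps)
  then have "0 \<le> K * q - 2 * K * (u \<bullet> v) + K * K * (v \<bullet> v)"
    using scalar_prod_self_nonneg[of w] K by simp
  also have "\<dots> = K * (q - 2 * (u \<bullet> v) + K * (v \<bullet> v))" by (simp add: algebra_simps)
  finally have "0 \<le> q - 2 * (u \<bullet> v) + K * (v \<bullet> v)" using K by (simp add: zero_le_mult_iff)
  then show ?thesis using d by (simp add: algebra_simps)
qed


section \<open>Boundary points\<close>

definition sqrt_abs_Lamm :: "'a boundary_data \<Rightarrow> 'a \<Rightarrow> real mat" where
  "sqrt_abs_Lamm p x = sqrt_diag (abs_diag (Lamm p x))"

definition bc_shift :: "'a boundary_data \<Rightarrow> 'a \<Rightarrow> real vec" where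
  "bc_shift p x = minv (bcS p x) *\<^sub>v dataG p x"

lemma index_sets [simp]: "pos_ind p x \<subseteq> {..<ncomp p}" "neg_ind p x \<subseteq> {..<ncomp p}"
  by (auto simp: pos_ind_def neg_ind_def)

lemma Lamp_diag: "Lamp p x = mat_diag (card (pos_ind p x)) (\<lambda>k. lam p x (pick (pos_ind p x) k))"
  and Lamm_diag: "Lamm p x = mat_diag (card (neg_ind p x)) (\<lambda>k. lam p x (pick (neg_ind p x) k))"
  by (simp_all add: Lamp_def Lamm_def Lam_def submatrix_mat_diag)

lemma abs_Lamm: "abs_diag (Lamm p x) = mat_diag (card (neg_ind p x)) (\<lambda>k. - lam p x (pick (neg_ind p x) k))"
proof -
  have "\<bar>lam p x (pick (neg_ind p x) k)\<bar> = - lam p x (pick (neg_ind p x) k)" if "k < card (neg_ind p x)" for k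
    using pick_in_set[of k "neg_ind p x"] that by (auto simp: neg_ind_def)
  then show ?thesis by (intro eq_matI) (auto simp: Lamm_diag mat_diag_def)
qed

lemma sqrt_abs_Lamm:
  shows sqrt_abs_Lamm_carrier: "sqrt_abs_Lamm p x \<in> carrier_mat (card (neg_ind p x)) (card (neg_ind p x))"
    and sqrt_abs_Lamm_transpose: "transpose_mat (sqrt_abs_Lamm p x) = sqrt_abs_Lamm p x"
    and sqrt_abs_Lamm_square: "sqrt_abs_Lamm p x * sqrt_abs_Lamm p x = abs_diag (Lamm p x)"
  by (simp_all add: sqrt_abs_Lamm_def Lamm_diag map_mat_diag transpose_mat_diag)

lemma Lamm_quadratic: "z \<in> carrier_vec (card (neg_ind p x)) \<Longrightarrow>
    z \<bullet> (abs_diag (Lamm p x) *\<^sub>v z) = - (z \<bullet> (Lamm p x *\<^sub>v z))"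
  unfolding abs_Lamm by (simp add: Lamm_diag mat_diag_quadratic sum_negf)

lemma boundary_problemD:
  assumes "boundary_problem p" "x \<in> frontier (region p)"
  shows "solU p x \<in> carrier_vec (ncomp p)"
    "trafoT p x \<in> carrier_mat (ncomp p) (ncomp p)" "invertible_mat (trafoT p x)"
    "solU p x \<bullet> (Atilde p x *\<^sub>v solU p x) = varW p x \<bullet> (Lam p x *\<^sub>v varW p x)"
    "bcR p x \<in> carrier_mat (card (neg_ind p x)) (card (pos_ind p x))"
    "bcS p x \<in> carrier_mat (card (neg_ind p x)) (card (neg_ind p x))" "invertible_mat (bcS p x)"
    "dataG p x \<in> carrier_vec (card (neg_ind p x))"
  using assms by (auto simp: boundary_problem_def smooth_field_def)

lemma Jm_carrier: "Jm p x \<in> carrier_mat (card (neg_ind p x)) (ncomp p)"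
proof -
  have "{i. i < ncomp p \<and> i \<in> neg_ind p x} = neg_ind p x" by (auto simp: neg_ind_def)
  then show ?thesis by (auto simp: Jm_def submatrix_def)
qed

lemma boundary_vec_carrier:
  assumes "boundary_problem p" "x \<in> frontier (region p)"
  shows "varW p x \<in> carrier_vec (ncomp p)"
    "varWp p x \<in> carrier_vec (card (pos_ind p x))" "varWm p x \<in> carrier_vec (card (neg_ind p x))"
    "bc_shift p x \<in> carrier_vec (card (neg_ind p x))" "bc_residual p x \<in> carrier_vec (card (neg_ind p x))"
proof -
  note d = boundary_problemD[OF assms]
  show W: "varW p x \<in> carrier_vec (ncomp p)"
    using d minv_carrier[OF d(2,3)] by (auto simp: varW_def)
  show Wp: "varWp p x \<in> carrier_vec (card (pos_ind p x))"
    using W by (simp add: varWp_def Jp_def submatrix_one_mult_vec)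
  show Wm: "varWm p x \<in> carrier_vec (card (neg_ind p x))"
    using W by (simp add: varWm_def Jm_def submatrix_one_mult_vec)
  show g: "bc_shift p x \<in> carrier_vec (card (neg_ind p x))"
    using d minv_carrier[OF d(6,7)] by (auto simp: bc_shift_def)
  show "bc_residual p x \<in> carrier_vec (card (neg_ind p x))"
    using g Wm Wp d by (auto simp: bc_residual_def bc_shift_def)
qed

text \<open>The indices with \<open>\<lambda>\<^sub>i = 0\<close> belong to neither block and contribute nothing.\<close>

lemma Lam_split:
  assumes "varW p x \<in> carrier_vec (ncomp p)"
  shows "varW p x \<bullet> (Lam p x *\<^sub>v varW p x) =
    varWp p x \<bullet> (Lamp p x *\<^sub>v varWp p x) + varWm p x \<bullet> (Lamm p x *\<^sub>v varWm p x)"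
proof -
  have "varW p x \<bullet> (Lam p x *\<^sub>v varW p x) = (\<Sum>i<ncomp p. lam p x i * (varW p x $ i)\<^sup>2)"
    using assms by (simp add: Lam_def mat_diag_quadratic)
  also have "\<dots> = (\<Sum>i\<in>pos_ind p x \<union> neg_ind p x. lam p x i * (varW p x $ i)\<^sup>2)"
    by (rule sum.mono_neutral_right) (auto simp: pos_ind_def neg_ind_def)
  also have "\<dots> = (\<Sum>i\<in>pos_ind p x. lam p x i * (varW p x $ i)\<^sup>2) + (\<Sum>i\<in>neg_ind p x. lam p x i * (varW p x $ i)\<^sup>2)"
    by (rule sum.union_disjoint) (auto simp: pos_ind_def neg_ind_def)
  finally show ?thesis
    using assms by (simp add: varWp_def varWm_def Jp_def Jm_def Lamp_def Lamm_def Lam_def block_quadratic)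
qed

lemma vec_diff_eq_iff:
  fixes a b g :: "real vec"
  assumes "a \<in> carrier_vec m" "b \<in> carrier_vec m" "g \<in> carrier_vec m"
  shows "a - b = g \<longleftrightarrow> a = b + g"
  using assms by (auto simp: vec_eq_iff algebra_simps)

lemma strong_form_iff_solved_form:
  assumes "boundary_problem p" "x \<in> frontier (region p)"
  shows "bcS p x *\<^sub>v (varWm p x - bcR p x *\<^sub>v varWp p x) = dataG p x \<longleftrightarrow>
    varWm p x = bcR p x *\<^sub>v varWp p x + minv (bcS p x) *\<^sub>v dataG p x"
proof -
  note d = boundary_problemD[OF assms] and c = boundary_vec_carrier[OF assms]
  let ?a = "varWm p x" and ?b = "bcR p x *\<^sub>v varWp p x" and ?g = "bc_shift p x"
  have ab: "?a \<in> carrier_vec (card (neg_ind p x))" "?b \<in> carrier_vec (card (neg_ind p x))"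
    using c d by auto
  have "bcS p x *\<^sub>v (?a - ?b) = dataG p x \<longleftrightarrow> ?a - ?b = ?g"
    using ab d unfolding bc_shift_def by (intro minv_solve) auto
  also have "\<dots> \<longleftrightarrow> ?a = ?b + ?g"
    using ab c(4) by (rule vec_diff_eq_iff)
  finally show ?thesis by (simp add: bc_shift_def)
qed

text \<open>
  The factor \<open>(J\<^sup>- T\<inverse>)\<^sup>T\<close> in the penalty is there to turn \<open>U\<close> into \<open>W\<^sup>-\<close>: it moves to the other
  side of the inner product.
\<close>

lemma penalty_pairing:
  assumes "boundary_problem p" "x \<in> frontier (region p)"
    and "penSigma p x \<in> carrier_mat (card (neg_ind p x)) (card (neg_ind p x))"
  shows "solU p x \<bullet> penalty p x = 2 * (varWm p x \<bullet> (penSigma p x *\<^sub>v bc_residual p x))"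
proof -
  note d = boundary_problemD[OF assms(1,2)] and c = boundary_vec_carrier[OF assms(1,2)]
  let ?m = "card (neg_ind p x)" and ?n = "ncomp p"
  let ?B = "Jm p x * minv (trafoT p x)" and ?z = "penSigma p x *\<^sub>v bc_residual p x"
  have B: "?B \<in> carrier_mat ?m ?n" by (rule mult_carrier_mat[OF Jm_carrier minv_carrier[OF d(2,3)]])
  have z: "?z \<in> carrier_vec ?m" using assms(3) c by auto
  have "transpose_mat ?B *\<^sub>v ?z \<in> carrier_vec ?n" using B z by simp
  then have "solU p x \<bullet> penalty p x = 2 * ((transpose_mat ?B *\<^sub>v ?z) \<bullet> solU p x)"
    using d(1) comm_scalar_prod[of "transpose_mat ?B *\<^sub>v ?z" ?n "solU p x"] by (simp add: penalty_def)
  also have "(transpose_mat ?B *\<^sub>v ?z) \<bullet> solU p x = ?z \<bullet> (?B *\<^sub>v solU p x)"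
    using B d(1) z by (rule transpose_vec_mult_scalar)
  also have "?B *\<^sub>v solU p x = varWm p x"
    unfolding varWm_def varW_def by (rule assoc_mult_mat_vec[OF Jm_carrier minv_carrier[OF d(2,3)] d(1)])
  also have "?z \<bullet> varWm p x = varWm p x \<bullet> ?z" using z c by (intro comm_scalar_prod)
  finally show ?thesis .
qed

lemma boundary_energy_identity:
  assumes "boundary_problem p" "x \<in> frontier (region p)"
  shows "varW p x \<bullet> (Lam p x *\<^sub>v varW p x) + 2 * (varWm p x \<bullet> (abs_diag (Lamm p x) *\<^sub>v bc_residual p x)) =
    varWp p x \<bullet> (schur_R p x *\<^sub>v varWp p x)
      - 2 * (((sqrt_abs_Lamm p x * bcR p x) *\<^sub>v varWp p x) \<bullet> (sqrt_abs_Lamm p x *\<^sub>v bc_shift p x))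
      - (sqrt_abs_Lamm p x *\<^sub>v bc_shift p x) \<bullet> (sqrt_abs_Lamm p x *\<^sub>v bc_shift p x)
      + (sqrt_abs_Lamm p x *\<^sub>v bc_residual p x) \<bullet> (sqrt_abs_Lamm p x *\<^sub>v bc_residual p x)"
proof -
  note d = boundary_problemD[OF assms] and c = boundary_vec_carrier[OF assms]
  have "Lamp p x \<in> carrier_mat (card (pos_ind p x)) (card (pos_ind p x))" by (simp add: Lamp_diag)
  from energy_identity[OF sqrt_abs_Lamm_carrier sqrt_abs_Lamm_transpose this d(5) c(2,3,4)]
  show ?thesis
    by (simp add: Lam_split[OF c(1)] Lamm_quadratic[OF c(3)] sqrt_abs_Lamm_square schur_R_def
        bc_residual_def bc_shift_def)
qed

lemma schur_R_carrier:
  assumes "boundary_problem p" "x \<in> frontier (region p)"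
  shows "schur_R p x \<in> carrier_mat (card (pos_ind p x)) (card (pos_ind p x))"
  using boundary_problemD(5)[OF assms] by (auto simp: schur_R_def)

lemma homogeneous_energy_nonneg:
  assumes "boundary_problem p" "x \<in> frontier (region p)" "homogeneous p" "cond_I p"
  shows "0 \<le> varW p x \<bullet> (Lam p x *\<^sub>v varW p x) + 2 * (varWm p x \<bullet> (abs_diag (Lamm p x) *\<^sub>v bc_residual p x))"
proof -
  note d = boundary_problemD[OF assms(1,2)] and c = boundary_vec_carrier[OF assms(1,2)]
  let ?Q = "sqrt_abs_Lamm p x" and ?m = "card (neg_ind p x)"
  note Q = sqrt_abs_Lamm_carrier[of p x]
  have "bc_shift p x = 0\<^sub>v ?m"
    using assms(2,3) minv_carrier[OF d(6,7)] by (auto simp: homogeneous_def bc_shift_def)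
  then have g: "?Q *\<^sub>v bc_shift p x = 0\<^sub>v ?m" using Q by auto
  have "(?Q * bcR p x) *\<^sub>v varWp p x \<in> carrier_vec ?m" using Q d c by auto
  then have "((?Q * bcR p x) *\<^sub>v varWp p x) \<bullet> (?Q *\<^sub>v bc_shift p x) = 0" by (simp add: g)
  moreover have "0 \<le> varWp p x \<bullet> (schur_R p x *\<^sub>v varWp p x)"
    using assms by (intro pos_semidef_nonneg[OF _ schur_R_carrier c(2)]) (auto simp: cond_I_def)
  moreover have "(?Q *\<^sub>v bc_shift p x) \<bullet> (?Q *\<^sub>v bc_shift p x) = 0" by (simp add: g)
  ultimately show ?thesis
    unfolding boundary_energy_identity[OF assms(1,2)]
    using scalar_prod_self_nonneg[of "?Q *\<^sub>v bc_residual p x"] by linarith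
qed


section \<open>The threshold for the inhomogeneous case\<close>

text \<open>
  The admissible constants for absorbing the mixed term, as a property of \<open>\<Lambda>\<^sup>+\<close>, \<open>\<Lambda>\<^sup>-\<close>, \<open>R\<close> alone,
  so that a threshold can be chosen from these three matrices.
\<close>

definition dominates :: "real mat \<Rightarrow> real mat \<Rightarrow> real mat \<Rightarrow> real \<Rightarrow> bool" where
  "dominates Lp Lm R K \<longleftrightarrow> 0 < K \<and> (\<forall>x \<in> carrier_vec (dim_col R).
     ((sqrt_diag (abs_diag Lm) * R) *\<^sub>v x) \<bullet> ((sqrt_diag (abs_diag Lm) * R) *\<^sub>v x)
       \<le> K * (x \<bullet> ((Lp - transpose_mat R * abs_diag Lm * R) *\<^sub>v x)))"

text \<open>
  The threshold \<open>\<delta>\<close> solves \<open>(1 + K) \<delta>\<^sup>2 = 1\<close>. The value 1 is a positive default where no \<open>K\<close> exists,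
  which cannot happen under the strict form of (I).
\<close>

definition threshold :: "real mat \<Rightarrow> real mat \<Rightarrow> real mat \<Rightarrow> real" where
  "threshold Lp Lm R = (if \<exists>K. dominates Lp Lm R K then 1 / sqrt (1 + (SOME K. dominates Lp Lm R K)) else 1)"

lemma threshold_pos: "0 < threshold Lp Lm R"
proof (cases "\<exists>K. dominates Lp Lm R K")
  case True
  then have "dominates Lp Lm R (SOME K. dominates Lp Lm R K)" by (rule someI_ex)
  then show ?thesis by (auto simp: threshold_def dominates_def intro: add_pos_pos)
qed (simp add: threshold_def)

lemma threshold_dominates:
  assumes "dominates Lp Lm R K0"
  obtains K where "dominates Lp Lm R K" "(1 + K) * (threshold Lp Lm R)\<^sup>2 = 1"
proof -
  have K: "dominates Lp Lm R (SOME K. dominates Lp Lm R K)" using assms by (rule someI)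
  then have "0 < (SOME K. dominates Lp Lm R K)" by (simp add: dominates_def)
  then show ?thesis
    using assms by (intro that[OF K]) (auto simp: threshold_def power_divide)
qed

text \<open>
  The reason for the form of (II): from \<open>S g = G\<close> and \<open>S = St\<inverse> |\<Lambda>\<^sup>-|\<^sup>1\<^sup>/\<^sup>2\<close> it follows that
  \<open>|\<Lambda>\<^sup>-|\<^sup>1\<^sup>/\<^sup>2 g = St G\<close>, so the size of \<open>\<Lambda>\<^sup>-\<close> drops out of the data term.
\<close>

lemma scaled_data:
  assumes "boundary_problem p" "x \<in> frontier (region p)"
    and St: "St \<in> carrier_mat (card (neg_ind p x)) (card (neg_ind p x))" "invertible_mat St"
    and S: "bcS p x = minv St * sqrt_diag (abs_diag (Lamm p x))"
  shows "sqrt_abs_Lamm p x *\<^sub>v bc_shift p x = St *\<^sub>v dataG p x"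
proof -
  note d = boundary_problemD[OF assms(1,2)] and c = boundary_vec_carrier[OF assms(1,2)]
  note Q = sqrt_abs_Lamm_carrier[of p x] and mSt = minv[OF St]
  let ?Qg = "sqrt_abs_Lamm p x *\<^sub>v bc_shift p x"
  have Qg: "?Qg \<in> carrier_vec (card (neg_ind p x))" using Q c by simp
  have "minv St *\<^sub>v ?Qg = bcS p x *\<^sub>v bc_shift p x"
    using S Q c mSt by (simp add: sqrt_abs_Lamm_def)
  also have "\<dots> = dataG p x" using minv_solve[OF d(6,7) c(4) d(8)] by (simp add: bc_shift_def)
  finally have "St *\<^sub>v dataG p x = St *\<^sub>v (minv St *\<^sub>v ?Qg)" by simp
  also have "\<dots> = (St * minv St) *\<^sub>v ?Qg" using St mSt(1) Qg by simp
  also have "\<dots> = ?Qg" using mSt(2) Qg by simp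
  finally show ?thesis by simp
qed

lemma inhomogeneous_energy_bound:
  assumes "boundary_problem p" "x \<in> frontier (region p)" "cond_I_strict p" "cond_II threshold p"
  shows "- (dataG p x \<bullet> dataG p x) \<le>
    varW p x \<bullet> (Lam p x *\<^sub>v varW p x) + 2 * (varWm p x \<bullet> (abs_diag (Lamm p x) *\<^sub>v bc_residual p x))"
proof -
  note d = boundary_problemD[OF assms(1,2)] and c = boundary_vec_carrier[OF assms(1,2)]
  let ?Q = "sqrt_abs_Lamm p x" and ?m = "card (neg_ind p x)" and ?G = "dataG p x"
  let ?v = "?Q *\<^sub>v bc_shift p x" and ?u = "(?Q * bcR p x) *\<^sub>v varWp p x"
  let ?\<delta> = "threshold (Lamp p x) (Lamm p x) (bcR p x)"
  note Q = sqrt_abs_Lamm_carrier[of p x]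
  have QR: "?Q * bcR p x \<in> carrier_mat ?m (card (pos_ind p x))" using Q d by auto
  have "pos_def (schur_R p x)" using assms by (auto simp: cond_I_strict_def)
  from pos_def_dominates[OF this schur_R_carrier[OF assms(1,2)] QR] obtain K0 where
    "0 < K0" "\<And>y. y \<in> carrier_vec (card (pos_ind p x)) \<Longrightarrow>
      ((?Q * bcR p x) *\<^sub>v y) \<bullet> ((?Q * bcR p x) *\<^sub>v y) \<le> K0 * (y \<bullet> (schur_R p x *\<^sub>v y))" by blast
  then have "dominates (Lamp p x) (Lamm p x) (bcR p x) K0"
    using d(5) by (auto simp: dominates_def schur_R_def sqrt_abs_Lamm_def)
  then obtain K where K: "dominates (Lamp p x) (Lamm p x) (bcR p x) K" "(1 + K) * ?\<delta>\<^sup>2 = 1"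
    by (rule threshold_dominates)
  have K0: "0 < K" "?u \<bullet> ?u \<le> K * (varWp p x \<bullet> (schur_R p x *\<^sub>v varWp p x))"
    using K(1) c(2) d(5) by (auto simp: dominates_def schur_R_def sqrt_abs_Lamm_def)
  obtain St where St: "St \<in> carrier_mat ?m ?m" "invertible_mat St"
    "bcS p x = minv St * sqrt_diag (abs_diag (Lamm p x))" "mat_norm St \<le> ?\<delta>"
    using assms by (auto simp: cond_II_def)
  have "?v \<bullet> ?v \<le> (mat_norm St)\<^sup>2 * (?G \<bullet> ?G)"
    unfolding scaled_data[OF assms(1,2) St(1,2,3)] by (rule mat_norm_bound[OF St(1) d(8)])
  also have "\<dots> \<le> ?\<delta>\<^sup>2 * (?G \<bullet> ?G)"
    using St(4) by (intro mult_right_mono power_mono mat_norm_nonneg scalar_prod_self_nonneg)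
  finally have "(1 + K) * (?v \<bullet> ?v) \<le> (1 + K) * (?\<delta>\<^sup>2 * (?G \<bullet> ?G))"
    using K0 by (intro mult_left_mono) auto
  then have "(1 + K) * (?v \<bullet> ?v) \<le> ?G \<bullet> ?G"
    using K(2) by (simp add: mult.assoc[symmetric])
  then have "- (?G \<bullet> ?G) \<le> varWp p x \<bullet> (schur_R p x *\<^sub>v varWp p x) - 2 * (?u \<bullet> ?v) - ?v \<bullet> ?v"
    using K0 QR Q c by (intro data_lower_bound[where K = K and m = ?m]) auto
  then show ?thesis
    unfolding boundary_energy_identity[OF assms(1,2)]
    using scalar_prod_self_nonneg[of "?Q *\<^sub>v bc_residual p x"] by linarith
qed


section \<open>Integration over the boundary\<close>

lemma surface_measure_cong:
  "(\<And>x. x \<in> frontier \<Omega> \<Longrightarrow> f x = g x) \<Longrightarrow> surface_integral \<Omega> f = surface_integral \<Omega> g"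
  by (rule Bochner_Integration.integral_cong) (auto simp: surface_measure_def space_restrict_space)

lemma surface_integral_nonneg:
  "(\<And>x. x \<in> frontier \<Omega> \<Longrightarrow> 0 \<le> f x) \<Longrightarrow> 0 \<le> surface_integral \<Omega> f"
  by (rule Bochner_Integration.integral_nonneg) (auto simp: surface_measure_def space_restrict_space)

lemma surface_integral_mono:
  "integrable (surface_measure \<Omega>) f \<Longrightarrow> integrable (surface_measure \<Omega>) g \<Longrightarrow>
   (\<And>x. x \<in> frontier \<Omega> \<Longrightarrow> f x \<le> g x) \<Longrightarrow> surface_integral \<Omega> f \<le> surface_integral \<Omega> g"
  by (rule integral_mono) (auto simp: surface_measure_def space_restrict_space)

text \<open>
  A strongly imposed condition has residual zero, so the penalty with weight \<open>|\<Lambda>\<^sup>-|\<close> may be added to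
  the density without changing it.
\<close>

lemma strong_energy:
  assumes "boundary_problem p" "strongly_imposed p" "x \<in> frontier (region p)"
  shows "solU p x \<bullet> (Atilde p x *\<^sub>v solU p x) =
    varW p x \<bullet> (Lam p x *\<^sub>v varW p x) + 2 * (varWm p x \<bullet> (abs_diag (Lamm p x) *\<^sub>v bc_residual p x))"
proof -
  note d = boundary_problemD[OF assms(1,3)] and c = boundary_vec_carrier[OF assms(1,3)]
  let ?m = "card (neg_ind p x)"
  have b: "bcR p x *\<^sub>v varWp p x \<in> carrier_vec ?m" using d c by auto
  have "varWm p x = bcR p x *\<^sub>v varWp p x + bc_shift p x"
    using assms by (auto simp: strongly_imposed_def bc_shift_def)
  then have "bc_residual p x = 0\<^sub>v ?m"
    using d(5) c(4) unfolding bc_residual_def bc_shift_def[symmetric] by (intro eq_vecI) auto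
  moreover have "abs_diag (Lamm p x) *\<^sub>v 0\<^sub>v ?m = 0\<^sub>v ?m"
    by (intro eq_vecI) (auto simp: abs_Lamm mat_diag_def)
  ultimately show ?thesis using d(4) c(3) by simp
qed

lemma weak_energy:
  assumes "boundary_problem p" "weakly_imposed p" "x \<in> frontier (region p)"
  shows "solU p x \<bullet> (Atilde p x *\<^sub>v solU p x) + solU p x \<bullet> penalty p x =
    varW p x \<bullet> (Lam p x *\<^sub>v varW p x) + 2 * (varWm p x \<bullet> (penSigma p x *\<^sub>v bc_residual p x))"
  using penalty_pairing[OF assms(1,3)] boundary_problemD(4)[OF assms(1,3)] assms(2,3)
  by (auto simp: weakly_imposed_def)

lemma weak_boundary_term_eq:
  assumes "boundary_problem p" "weakly_imposed p"
  shows "weak_boundary_term p =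
    surface_integral (region p) (\<lambda>x. solU p x \<bullet> (Atilde p x *\<^sub>v solU p x) + solU p x \<bullet> penalty p x)"
  using assms by (simp add: weak_boundary_term_def boundary_term_def lifting_def
      boundary_problem_def weakly_imposed_def)

lemma data_term_bound:
  assumes "boundary_problem p" "integrable (surface_measure (region p)) f"
    and "\<And>x. x \<in> frontier (region p) \<Longrightarrow> - (dataG p x \<bullet> dataG p x) \<le> f x"
  shows "- data_term p \<le> surface_integral (region p) f"
proof -
  have i: "integrable (surface_measure (region p)) (\<lambda>x. dataG p x \<bullet> dataG p x)"
    using assms(1) by (simp add: boundary_problem_def)
  have "surface_integral (region p) (\<lambda>x. - (dataG p x \<bullet> dataG p x)) \<le> surface_integral (region p) f"
    using i assms(2,3) by (intro surface_integral_mono) auto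
  then show ?thesis by (simp add: data_term_def)
qed

theorem lemma3p2:
  shows "
    (\<forall>p :: 'a::euclidean_space boundary_data. boundary_problem p \<longrightarrow>
        boundary_term p = surface_integral (region p) (\<lambda>x. scalar_prod (varW p x) (Lam p x *\<^sub>v varW p x)) \<and>
        boundary_term p = surface_integral (region p)
          (\<lambda>x. scalar_prod (varWp p x) (Lamp p x *\<^sub>v varWp p x) + scalar_prod (varWm p x) (Lamm p x *\<^sub>v varWm p x)) \<and>
        (\<forall>x\<in>frontier (region p).
           bcS p x *\<^sub>v (varWm p x - bcR p x *\<^sub>v varWp p x) = dataG p x \<longleftrightarrow>
           varWm p x = bcR p x *\<^sub>v varWp p x + minv (bcS p x) *\<^sub>v dataG p x) \<and>
        (weakly_imposed p \<longrightarrow>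
           weak_boundary_term p = surface_integral (region p)
             (\<lambda>x. scalar_prod (varW p x) (Lam p x *\<^sub>v varW p x) +
                  2 * scalar_prod (varWm p x) (penSigma p x *\<^sub>v bc_residual p x)))) \<and>

    (\<forall>p :: 'a boundary_data.
        boundary_problem p \<and> strongly_imposed p \<and> homogeneous p \<and> cond_I p \<longrightarrow>
        0 \<le> boundary_term p) \<and>

    (\<exists>\<delta>. (\<forall>Lp Lm R. 0 < \<delta> Lp Lm R) \<and>
        (\<forall>p :: 'a boundary_data.
           boundary_problem p \<and> strongly_imposed p \<and> cond_I_strict p \<and> cond_II \<delta> p \<longrightarrow>
           - data_term p \<le> boundary_term p)) \<and>

    (\<forall>p :: 'a boundary_data.
        boundary_problem p \<and> weakly_imposed p \<and> homogeneous p \<and> cond_I p \<and> cond_III p \<longrightarrow>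
        0 \<le> weak_boundary_term p) \<and>

    (\<exists>\<delta>. (\<forall>Lp Lm R. 0 < \<delta> Lp Lm R) \<and>
        (\<forall>p :: 'a boundary_data.
           boundary_problem p \<and> weakly_imposed p \<and> cond_I_strict p \<and> cond_II \<delta> p \<and> cond_III p \<longrightarrow>
           - data_term p \<le> weak_boundary_term p))"
proof (intro conjI allI impI ballI exI[of _ threshold] threshold_pos; (elim conjE)?)
  fix p :: "'a boundary_data" assume p: "boundary_problem p"
  show "boundary_term p = surface_integral (region p) (\<lambda>x. varW p x \<bullet> (Lam p x *\<^sub>v varW p x))"
    unfolding boundary_term_def by (intro surface_measure_cong boundary_problemD(4)[OF p])
  then show "boundary_term p = surface_integral (region p)
      (\<lambda>x. varWp p x \<bullet> (Lamp p x *\<^sub>v varWp p x) + varWm p x \<bullet> (Lamm p x *\<^sub>v varWm p x))"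
    using surface_measure_cong[OF Lam_split[OF boundary_vec_carrier(1)[OF p]]] by simp
  show "bcS p x *\<^sub>v (varWm p x - bcR p x *\<^sub>v varWp p x) = dataG p x \<longleftrightarrow>
      varWm p x = bcR p x *\<^sub>v varWp p x + minv (bcS p x) *\<^sub>v dataG p x" if "x \<in> frontier (region p)" for x
    by (rule strong_form_iff_solved_form[OF p that])
  show "weak_boundary_term p = surface_integral (region p) (\<lambda>x. varW p x \<bullet> (Lam p x *\<^sub>v varW p x) +
      2 * (varWm p x \<bullet> (penSigma p x *\<^sub>v bc_residual p x)))" if "weakly_imposed p"
    unfolding weak_boundary_term_eq[OF p that] by (intro surface_measure_cong weak_energy[OF p that])
next
  fix p :: "'a boundary_data"
  assume p: "boundary_problem p" "strongly_imposed p" "homogeneous p" "cond_I p"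
  show "0 \<le> boundary_term p"
    unfolding boundary_term_def
    using homogeneous_energy_nonneg[OF p(1) _ p(3,4)] strong_energy[OF p(1,2)]
    by (intro surface_integral_nonneg) simp
next
  fix p :: "'a boundary_data"
  assume p: "boundary_problem p" "strongly_imposed p" "cond_I_strict p" "cond_II threshold p"
  show "- data_term p \<le> boundary_term p"
    unfolding boundary_term_def
  proof (rule data_term_bound[OF p(1)])
    show "integrable (surface_measure (region p)) (\<lambda>x. solU p x \<bullet> (Atilde p x *\<^sub>v solU p x))"
      using p by (simp add: boundary_problem_def)
  qed (use inhomogeneous_energy_bound[OF p(1) _ p(3,4)] strong_energy[OF p(1,2)] in simp)
next
  fix p :: "'a boundary_data"
  assume p: "boundary_problem p" "weakly_imposed p" "homogeneous p" "cond_I p" "cond_III p"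
  show "0 \<le> weak_boundary_term p"
    unfolding weak_boundary_term_eq[OF p(1,2)]
    using homogeneous_energy_nonneg[OF p(1) _ p(3,4)] weak_energy[OF p(1,2)] p(5)
    by (intro surface_integral_nonneg) (simp add: cond_III_def)
next
  fix p :: "'a boundary_data"
  assume p: "boundary_problem p" "weakly_imposed p" "cond_I_strict p" "cond_II threshold p" "cond_III p"
  show "- data_term p \<le> weak_boundary_term p"
    unfolding weak_boundary_term_eq[OF p(1,2)]
  proof (rule data_term_bound[OF p(1)])
    show "integrable (surface_measure (region p))
        (\<lambda>x. solU p x \<bullet> (Atilde p x *\<^sub>v solU p x) + solU p x \<bullet> penalty p x)"
      using p by (simp add: boundary_problem_def weakly_imposed_def)
  qed (use inhomogeneous_energy_bound[OF p(1) _ p(3,4)] weak_energy[OF p(1,2)] p(5) in \<open>simp add: cond_III_def\<close>)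
qed

end
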